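(* Let $1<\sigma<2$, $T>0$, $b\in\mathbb{R}$ with $b\neq 0$, let $T_0$ be the existence time defined in the context, and let $T_0^*=\min\{T_0,1\}$. Let $f$ be such that $f(x,t_1,t_2)\in C\big((0,T]\times\mathbb{R}\times\mathbb{R}\big)$ and $x^{\sigma-1}f(x,t_1,t_2)\in C\big([0,T]\times\mathbb{R}\times\mathbb{R}\big)$. Suppose that for all $x\in[0,T]$ and all $t_{1,i},t_{2,i}\in\mathbb{R}$ with $i=1,2$, the inequality $$x^{\sigma-1}\left|f(x,t_{1,1},t_{2,1})-f(x,t_{1,2},t_{2,2})\right|\leq C\left(g\left(\left|t_{1,1}-t_{1,2}\right|^{p}+\left|t_{2,1}-t_{2,2}\right|^{p}\right)\right)^{1/p}$$ is fulfilled, where $p>1$ is the conjugate exponent ($1/p+1/q=1$) of some $q>1$ satisfying $1+(1-\sigma)q>0$, the constant $C>0$ satisfies $$C^{q}\geq 2\max\left(b\,\Gamma^{q}(\sigma)\big[T_0\,\Gamma(1+(1-\sigma)q)\,\Gamma(1+(\sigma-1)q)\big]^{-1},\ (1+(1-\sigma)q)\,T_0^{-1-q(1-\sigma)}\right),$$ and $g:[0,\infty)\to[0,\infty)$ is a continuous, non-negative and non-decreasing function with $g(0)=0$ and $$\lim_{\epsilon\to0^+}\int_{\epsilon}^{\gamma}\frac{du}{g(u)}=\infty\quad\text{for any }\gamma>0.$$ Then the initial value problem $$D^{\sigma}\omega(x)=f\big(x,\omega(x),D^{\sigma-1}\omega(x)\big),\quad x>0,\qquad \omega(0)=0,\quad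 D^{\sigma-1}\omega(x)|_{x=0}=b,$$ has a unique solution in the space $C^{\sigma-1}([0,T_0^*])$.
   Context: $C(X)$ denotes the class of continuous functions on $X$; the condition $x^{\sigma-1}f\in C([0,T]\times\mathbb{R}\times\mathbb{R})$ means that $(x,t_1,t_2)\mapsto x^{\sigma-1}f(x,t_1,t_2)$ extends continuously to $x=0$, and at $x=0$ such expressions are understood via this extension. For $1<\sigma<2$, the Riemann-Liouville derivatives (lower terminal $0$) are $$D^{\sigma}\omega(x)=\frac{1}{\Gamma(2-\sigma)}\frac{d^2}{dx^2}\int_0^x\frac{\omega(t)}{(x-t)^{\sigma-1}}dt,\qquad D^{\sigma-1}\omega(x)=\frac{1}{\Gamma(2-\sigma)}\frac{d}{dx}\int_0^x\frac{\omega(t)}{(x-t)^{\sigma-1}}dt.$$ For $0<\beta<1$ and $a>0$, $C^{\beta}([0,a])$ is the space of continuous functions on $[0,a]$ whose Riemann-Liouville derivative $D^{\beta}\omega$ is continuous on $[0,a]$, with norm $\|\omega\|_\infty+\|D^\beta\omega\|_\infty$. Existence time $T_0$: let $r,\mathcal{M}>0$ be such that $|x^{\sigma-1}f(x,w,v)|\le\mathcal{M}$ for all $(x,w,v)\in[0,T]\times[-r_1,r_1]\times[b-r_2,b+r_2]$ with $r_1+r_2\le r$. Put $C(b,\sigma,\mathcal{M})=\frac{|b|}{\Gamma(\sigma)}+\mathcal{M}\left(\frac{1+\Gamma(3-\sigma)}{2-\sigma}\right)$ and $\rho=r/C(b,\sigma,\mathcal{M})$. Then $$T_0=\begin{cases}T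 & \text{if } T<\rho,\\ \rho & \text{if } T\ge\rho\ge1,\\ \rho^{\sigma-1} & \text{if } T\ge\rho,\ 1\ge\rho \text{ and } 1<\sigma\le1.5,\\ \rho^{2-\sigma} & \text{if } T\ge\rho,\ 1\ge\rho\text{ and } 1.5\le\sigma<2.\end{cases}$$
   Formalization: The unique solution is asserted in C^{σ-1}([0,min{T_0^*,T}]) rather than C^{σ-1}([0,T_0^*]): T_0^* can exceed T (e.g. T=ρ=1/2, σ=1.5), where f is not defined beyond T; when T_0^*≤T the claim is unchanged. *)

theory Defs
  imports "HOL-Analysis.Analysis"
begin

text \<open>
  Functions on an interval \<open>[0,a]\<close> are represented by total functions whose values outside
  \<open>[0,a]\<close> are irrelevant. All derivatives are taken within \<open>[0,a]\<close>: they are two-sided at interior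
  points and one-sided at the end points.
\<close>

definition RL_integral :: "real \<Rightarrow> (real \<Rightarrow> real) \<Rightarrow> real \<Rightarrow> real" where
  "RL_integral \<beta> \<omega> x = integral {0..x} (\<lambda>t. \<omega> t / (x - t) powr \<beta>)"

text \<open>
  The derivative of order \<open>\<beta>\<close> with \<open>0 < \<beta> < 1\<close>; for \<open>\<beta> = \<sigma> - 1\<close> the factor is \<open>1 / \<Gamma>(2 - \<sigma>)\<close>.
  The value is meaningful only where the differentiated function is differentiable, which is
  required separately below.
\<close>

definition RL_deriv :: "real \<Rightarrow> real \<Rightarrow> (real \<Rightarrow> real) \<Rightarrow> real \<Rightarrow> real" where
  "RL_deriv \<beta> a \<omega> x =
     1 / Gamma (1 - \<beta>) * vector_derivative (RL_integral \<beta> \<omega>) (at x within {0..a})"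

definition RL_space :: "real \<Rightarrow> real \<Rightarrow> (real \<Rightarrow> real) set" where
  "RL_space \<beta> a = {\<omega>. continuous_on {0..a} \<omega> \<and>
     (\<forall>x\<in>{0..a}. RL_integral \<beta> \<omega> differentiable (at x within {0..a})) \<and>
     continuous_on {0..a} (RL_deriv \<beta> a \<omega>)}"

text \<open>The derivative of order \<open>\<sigma>\<close> with \<open>1 < \<sigma> < 2\<close>, under the same proviso.\<close>

definition RL_deriv2 :: "real \<Rightarrow> real \<Rightarrow> (real \<Rightarrow> real) \<Rightarrow> real \<Rightarrow> real" where
  "RL_deriv2 \<sigma> a \<omega> x =
     1 / Gamma (2 - \<sigma>) *
       vector_derivative
         (\<lambda>y. vector_derivative (RL_integral (\<sigma> - 1) \<omega>) (at y within {0..a}))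
         (at x within {0..a})"

definition RL_twice_differentiable :: "real \<Rightarrow> real \<Rightarrow> (real \<Rightarrow> real) \<Rightarrow> real \<Rightarrow> bool" where
  "RL_twice_differentiable \<sigma> a \<omega> x \<longleftrightarrow>
     (\<forall>y\<in>{0<..a}. RL_integral (\<sigma> - 1) \<omega> differentiable (at y within {0..a})) \<and>
     (\<lambda>y. vector_derivative (RL_integral (\<sigma> - 1) \<omega>) (at y within {0..a}))
       differentiable (at x within {0..a})"

definition is_solution ::
  "real \<Rightarrow> real \<Rightarrow> real \<Rightarrow> (real \<times> real \<times> real \<Rightarrow> real) \<Rightarrow> (real \<Rightarrow> real) \<Rightarrow> bool" where
  "is_solution \<sigma> b a f \<omega> \<longleftrightarrow>
     (\<forall>x\<in>{0<..a}. RL_twice_differentiable \<sigma> a \<omega> x \<and>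
        RL_deriv2 \<sigma> a \<omega> x = f (x, \<omega> x, RL_deriv (\<sigma> - 1) a \<omega> x)) \<and>
     \<omega> 0 = 0 \<and> RL_deriv (\<sigma> - 1) a \<omega> 0 = b"

definition bound_const :: "real \<Rightarrow> real \<Rightarrow> real \<Rightarrow> real" where
  "bound_const b \<sigma> M = \<bar>b\<bar> / Gamma \<sigma> + M * ((1 + Gamma (3 - \<sigma>)) / (2 - \<sigma>))"

definition existence_time :: "real \<Rightarrow> real \<Rightarrow> real \<Rightarrow> real \<Rightarrow> real \<Rightarrow> real" where
  "existence_time \<sigma> T b r M =
     (let \<rho> = r / bound_const b \<sigma> M in
      if T < \<rho> then T
      else if \<rho> \<ge> 1 then \<rho>
      else if \<sigma> \<le> 3 / 2 then \<rho> powr (\<sigma> - 1)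
      else \<rho> powr (2 - \<sigma>))"

text \<open>
  The integral is the \<open>[0,\<infty>]\<close>-valued one, with \<open>1 / 0 = \<infty>\<close>, so that \<open>g\<close> may vanish near \<open>0\<close>.
\<close>

definition osgood :: "(real \<Rightarrow> real) \<Rightarrow> bool" where
  "osgood g \<longleftrightarrow> (\<forall>\<gamma>>0.
     ((\<lambda>\<epsilon>. \<integral>\<^sup>+u\<in>{\<epsilon>..\<gamma>}. (1 / ennreal (g u)) \<partial>lborel) \<longlongrightarrow> top) (at_right 0))"

text \<open>
  \<open>F\<close> is the continuous extension of \<open>x\<^sup>\<sigma>\<^sup>-\<^sup>1 f(x,t\<^sub>1,t\<^sub>2)\<close> to \<open>x = 0\<close>; for \<open>T > 0\<close> its restriction to
  \<open>[0,T] \<times> \<real> \<times> \<real>\<close> is determined by \<open>f\<close>.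
\<close>

definition weighted_extension ::
  "real \<Rightarrow> real \<Rightarrow> (real \<times> real \<times> real \<Rightarrow> real) \<Rightarrow> (real \<times> real \<times> real \<Rightarrow> real) \<Rightarrow> bool" where
  "weighted_extension \<sigma> T f F \<longleftrightarrow>
     continuous_on ({0..T} \<times> UNIV \<times> UNIV) F \<and>
     (\<forall>x\<in>{0<..T}. \<forall>w v. F (x, w, v) = x powr (\<sigma> - 1) * f (x, w, v))"

end

theory Submission
  imports Defs "HOL-Complex_Analysis.Great_Picard"
begin

text \<open>
  Put \<open>\<beta> = \<sigma> - 1\<close> and \<open>v = D\<^sup>\<beta> \<omega>\<close>. Abel's identity \<open>I\<^sup>\<beta> I\<^sup>1\<^sup>-\<^sup>\<beta> = I\<^sup>1\<close> shows that \<open>\<omega>\<close> solves the problem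
  iff \<open>\<omega> = J v\<close> with \<open>J = I\<^sup>\<beta>\<close> and \<open>v x = b + \<integral>\<^sub>0\<^sup>x t\<^sup>-\<^sup>\<beta> F (t, J v t, v t) dt\<close>. On monomials the identity is the
  Beta integral, and the general case follows by Weierstrass approximation.

  Walking from \<open>(0, 0)\<close> to \<open>(w, v)\<close> in steps of length at most one, the modulus of continuity of \<open>F\<close> gives
  \<open>\<bar>F (x, w, v)\<bar> \<le> L (1 + \<bar>w\<bar> + \<bar>v\<bar>)\<close>. Hence the solutions of the equation with a time delay \<open>h\<close> in the
  upper limit are bounded uniformly in \<open>h\<close>, and the Arzela-Ascoli theorem yields a solution as \<open>h \<rightarrow> 0\<close>.

  For two solutions put \<open>\<Phi> = \<bar>J v - J w\<bar>\<^sup>p + \<bar>v - w\<bar>\<^sup>p\<close>. Hoelder's inequality for the measure \<open>t\<^sup>-\<^sup>\<beta> dt\<close> gives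
  \<open>\<Phi> x \<le> K \<integral>\<^sub>0\<^sup>x t\<^sup>-\<^sup>\<beta> g (\<Phi> t) dt\<close>, and Osgood's criterion forces \<open>\<Phi> = 0\<close>.
\<close>

section \<open>Abel's identity\<close>

lemma has_integral_RL_kernel:
  fixes \<alpha> x :: real
  assumes "\<alpha> < 1" "0 \<le> x"
  shows "((\<lambda>t. 1 / (x - t) powr \<alpha>) has_integral x powr (1 - \<alpha>) / (1 - \<alpha>)) {0..x}"
proof -
  have "((\<lambda>t. t powr - \<alpha>) has_integral x powr (1 - \<alpha>) / (1 - \<alpha>)) (cbox 0 x)"
    using has_integral_powr_from_0[of "-\<alpha>" x] assms by simp
  \<comment> \<open>The reflection \<open>t \<mapsto> x - t\<close> moves the singularity from
    \<open>0\<close> to \<open>x\<close>.\<close>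
  from has_integral_affinity[OF this, of "-1" x] assms
  show ?thesis
    by (simp add: powr_minus_divide image_diff_atLeastAtMost[of x 0 x, simplified])
qed

text \<open>A nonnegative integrable kernel is absolutely integrable, and on a compact interval the
  continuous factor is bounded and measurable. This covers kernels that blow up at an end
  point.\<close>

lemma continuous_mult_integrable:
  fixes h k :: "real \<Rightarrow> real"
  assumes "continuous_on {a..b} h" "k integrable_on {a..b}" "\<And>t. t \<in> {a..b} \<Longrightarrow> 0 \<le> k t"
  shows "(\<lambda>t. h t * k t) integrable_on {a..b}"
proof -
  have "k absolutely_integrable_on {a..b}"
    using assms(2,3) by (intro nonnegative_absolutely_integrable_1) auto
  moreover have "h \<in> borel_measurable (lebesgue_on {a..b})"
    using assms(1) by (intro continuous_imp_measurable_on_sets_lebesgue) auto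
  moreover have "bounded (h ` {a..b})"
    using assms(1) by (intro compact_imp_bounded compact_continuous_image) auto
  ultimately show ?thesis
    using absolutely_integrable_bounded_measurable_product_real[of h "{a..b}" k]
    by (auto intro: set_lebesgue_integral_eq_integral(1))
qed

lemma RL_integrand_integrable:
  fixes \<alpha> x :: real
  assumes "\<alpha> < 1" "0 \<le> x" "continuous_on {0..x} h"
  shows "(\<lambda>t. h t / (x - t) powr \<alpha>) integrable_on {0..x}"
proof -
  have "(\<lambda>t. h t * (1 / (x - t) powr \<alpha>)) integrable_on {0..x}"
    using has_integral_RL_kernel[OF assms(1,2)] by (intro continuous_mult_integrable assms(3)) auto
  then show ?thesis by simp
qed

lemma RL_integral_cong:
  assumes "\<And>t. t \<in> {0..x} \<Longrightarrow> h t = k t"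
  shows "RL_integral \<alpha> h x = RL_integral \<alpha> k x"
  unfolding RL_integral_def by (rule integral_cong) (simp add: assms)

lemma RL_integral_diff:
  assumes "\<alpha> < 1" "0 \<le> x" "continuous_on {0..x} h" "continuous_on {0..x} k"
  shows "RL_integral \<alpha> (\<lambda>t. h t - k t) x = RL_integral \<alpha> h x - RL_integral \<alpha> k x"
  unfolding RL_integral_def diff_divide_distrib
  by (intro integral_diff RL_integrand_integrable assms)

lemma RL_integral_cmult: "RL_integral \<alpha> (\<lambda>t. c * h t) x = c * RL_integral \<alpha> h x"
  unfolding RL_integral_def by (simp flip: times_divide_eq_right)

lemma RL_integral_sum:
  assumes "\<alpha> < 1" "0 \<le> x" "finite A" "\<And>i. i \<in> A \<Longrightarrow> continuous_on {0..x} (h i)"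
  shows "RL_integral \<alpha> (\<lambda>t. \<Sum>i\<in>A. h i t) x = (\<Sum>i\<in>A. RL_integral \<alpha> (h i) x)"
  unfolding RL_integral_def sum_divide_distrib
  by (intro integral_sum RL_integrand_integrable assms)

text \<open>The kernel has finite mass. Hence the operator respects uniform convergence, on which
  the approximation arguments below rest.\<close>

lemma RL_integral_bound:
  assumes "\<alpha> < 1" "0 \<le> x" "continuous_on {0..x} h" "\<And>t. t \<in> {0..x} \<Longrightarrow> \<bar>h t\<bar> \<le> B"
  shows "\<bar>RL_integral \<alpha> h x\<bar> \<le> B * (x powr (1 - \<alpha>) / (1 - \<alpha>))"
proof -
  have "norm (integral {0..x} (\<lambda>t. h t / (x - t) powr \<alpha>)) \<le> integral {0..x} (\<lambda>t. B * (1 / (x - t) powr \<alpha>))"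
  proof (rule integral_norm_bound_integral)
    show "(\<lambda>t. B * (1 / (x - t) powr \<alpha>)) integrable_on {0..x}"
      using has_integral_mult_right[OF has_integral_RL_kernel[OF assms(1,2)]] by blast
    show "norm (h t / (x - t) powr \<alpha>) \<le> B * (1 / (x - t) powr \<alpha>)" if "t \<in> {0..x}" for t
      using assms(4)[OF that] by (simp add: divide_right_mono)
  qed (intro RL_integrand_integrable assms)
  also have "integral {0..x} (\<lambda>t. B * (1 / (x - t) powr \<alpha>)) = B * (x powr (1 - \<alpha>) / (1 - \<alpha>))"
    by (intro integral_unique has_integral_mult_right has_integral_RL_kernel assms)
  finally show ?thesis by (simp add: RL_integral_def)
qed

text \<open>The substitution \<open>t = x * s\<close> reduces the integral to the Beta integral over
  \<open>[0,1]\<close>.\<close>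

lemma RL_integral_powr:
  assumes "\<alpha> < 1" "0 \<le> c" "0 \<le> x"
  shows "RL_integral \<alpha> (\<lambda>t. t powr c) x = Beta (c + 1) (1 - \<alpha>) * x powr (c + 1 - \<alpha>)"
proof (cases "x = 0")
  case True
  then show ?thesis by (simp add: RL_integral_def)
next
  case False
  with assms have x: "x > 0" by simp
  have "((\<lambda>t. t powr (c + 1 - 1) * (1 - t) powr (1 - \<alpha> - 1)) has_integral Beta (c + 1) (1 - \<alpha>)) {0..1}"
    by (rule has_integral_Beta_real) (use assms in auto)
  hence "((\<lambda>t. (t / x) powr c * (1 - t / x) powr (- \<alpha>)) has_integral x * Beta (c + 1) (1 - \<alpha>)) ((\<lambda>t. t * x) ` {0..1})"
    using has_integral_stretch_real[of _ _ 0 1 "1 / x"] x by fastforce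
  also have "(\<lambda>t. t * x) ` {0..1} = {0..x}"
    using image_mult_atLeastAtMost[of x 0 1] x by (simp add: mult.commute)
  finally have "((\<lambda>t. x powr (c - \<alpha>) * ((t / x) powr c * (1 - t / x) powr (- \<alpha>))) has_integral
      x powr (c - \<alpha>) * (x * Beta (c + 1) (1 - \<alpha>))) {0..x}"
    by (rule has_integral_mult_right)
  also have "x powr (c - \<alpha>) * (x * Beta (c + 1) (1 - \<alpha>)) = Beta (c + 1) (1 - \<alpha>) * x powr (c + 1 - \<alpha>)"
    using x powr_add[of x "c - \<alpha>" 1] by (simp add: algebra_simps)
  finally have "((\<lambda>t. t powr c / (x - t) powr \<alpha>) has_integral Beta (c + 1) (1 - \<alpha>) * x powr (c + 1 - \<alpha>)) {0..x}"
  proof (rule has_integral_eq[rotated])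
    fix t assume t: "t \<in> {0..x}"
    have "1 - t / x = (x - t) / x" using x by (simp add: field_simps)
    \<comment> \<open>The factor \<open>x powr (c - \<alpha>)\<close> undoes the scaling. At
      \<open>t = x\<close> both sides are \<open>0\<close>, because \<open>0 powr y = 0\<close> and
      \<open>y / 0 = 0\<close>.\<close>
    then show "x powr (c - \<alpha>) * ((t / x) powr c * (1 - t / x) powr (- \<alpha>)) = t powr c / (x - t) powr \<alpha>"
      using x t by (simp add: powr_divide powr_diff powr_minus field_simps)
  qed
  then show ?thesis unfolding RL_integral_def by (rule integral_unique)
qed

lemma RL_integral_power:
  assumes "\<alpha> < 1" "0 \<le> x"
  shows "RL_integral \<alpha> (\<lambda>t. t ^ n) x = Beta (real n + 1) (1 - \<alpha>) * x powr (real n + 1 - \<alpha>)"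
proof -
  have "RL_integral \<alpha> (\<lambda>t. t ^ n) x = RL_integral \<alpha> (\<lambda>t. t powr real n) x"
  proof (cases "n = 0")
    case True
    \<comment> \<open>\<open>t ^ 0\<close> is \<open>1\<close> at \<open>t = 0\<close>, but
      \<open>0 powr 0\<close> is \<open>0\<close>; the integrands can differ only at this one point,
      which is negligible.\<close>
    have "integral {0..x} (\<lambda>t. 1 / (x - t) powr \<alpha>) = integral {0..x} (\<lambda>t. t powr 0 / (x - t) powr \<alpha>)"
      by (rule integral_spike[of "{0}"]) auto
    with True show ?thesis by (simp add: RL_integral_def)
  next
    case False
    then show ?thesis by (intro RL_integral_cong) (simp add: powr_realpow')
  qed
  then show ?thesis using RL_integral_powr[OF assms(1) _ assms(2)] by simp
qed

lemma RL_integral_polynomial: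
  assumes "\<alpha> < 1" "0 \<le> x"
  shows "RL_integral \<alpha> (\<lambda>t. \<Sum>i\<le>n. c i * t ^ i) x =
    (\<Sum>i\<le>n. c i * (Beta (real i + 1) (1 - \<alpha>) * x powr (real i + 1 - \<alpha>)))"
  by (subst RL_integral_sum)
     (auto simp: RL_integral_cmult RL_integral_power assms intro!: continuous_intros)

lemma polynomial_approximation:
  fixes h :: "real \<Rightarrow> real"
  assumes "continuous_on {a..b} h" "0 < e"
  obtains c n where "\<And>t. t \<in> {a..b} \<Longrightarrow> \<bar>h t - (\<Sum>i\<le>n. c i * t ^ i)\<bar> < e"
  using Stone_Weierstrass_real_polynomial_function[OF compact_Icc assms] real_polynomial_function_iff_sum
  by metis

text \<open>For a polynomial the integral is a combination of nonnegative powers of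
  \<open>x\<close>, hence continuous. Weierstrass approximation of \<open>h\<close> and
  \<open>RL_integral_bound\<close> exhibit the general case as a uniform limit of these.\<close>

lemma continuous_on_RL_integral:
  assumes "\<alpha> < 1" "0 \<le> a" "continuous_on {0..a} h"
  shows "continuous_on {0..a} (RL_integral \<alpha> h)"
proof -
  define B where "B = a powr (1 - \<alpha>) / (1 - \<alpha>)"
  have B: "B \<ge> 0" using assms by (simp add: B_def)
  have "\<exists>p. continuous_on {0..a} p \<and> (\<forall>x\<in>{0..a}. dist (p x) (RL_integral \<alpha> h x) < e)" if "e > 0" for e
  proof -
    \<comment> \<open>The summand \<open>1\<close> in \<open>B + 1\<close> avoids a zero denominator
      and makes the final estimate strict.\<close>
    obtain c n where c: "\<And>t. t \<in> {0..a} \<Longrightarrow> \<bar>h t - (\<Sum>i\<le>n. c i * t ^ i)\<bar> < e / (B + 1)"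
      using polynomial_approximation[OF assms(3), of "e / (B + 1)"] \<open>e > 0\<close> B by auto
    let ?P = "\<lambda>t. \<Sum>i\<le>n. c i * t ^ i"
    have eq: "RL_integral \<alpha> ?P x = (\<Sum>i\<le>n. c i * (Beta (real i + 1) (1 - \<alpha>) * x powr (real i + 1 - \<alpha>)))"
      if "x \<in> {0..a}" for x
      using that assms by (intro RL_integral_polynomial) auto
    have cont: "continuous_on {0..a} (RL_integral \<alpha> ?P)"
      by (subst continuous_on_cong[OF refl eq])
        (use assms(1) in \<open>auto intro!: continuous_intros continuous_on_powr'\<close>)
    have "dist (RL_integral \<alpha> ?P x) (RL_integral \<alpha> h x) < e" if x: "x \<in> {0..a}" for x
    proof -
      have hx: "continuous_on {0..x} h" using x by (intro continuous_on_subset[OF assms(3)]) auto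
      have px: "continuous_on {0..x} ?P" by (intro continuous_intros)
      have "\<bar>RL_integral \<alpha> (\<lambda>t. h t - ?P t) x\<bar> \<le> e / (B + 1) * (x powr (1 - \<alpha>) / (1 - \<alpha>))"
        using x c assms by (intro RL_integral_bound continuous_on_diff hx px) (auto intro: less_imp_le)
      also have "\<dots> \<le> e / (B + 1) * B"
        unfolding B_def[symmetric] using x assms \<open>e > 0\<close> B
        by (intro mult_left_mono) (auto simp: B_def intro!: divide_right_mono powr_mono2)
      also have "\<dots> < e" using \<open>e > 0\<close> B by (simp add: field_simps)
      finally show ?thesis
        using RL_integral_diff[OF assms(1) _ hx px] x by (simp add: dist_real_def abs_minus_commute)
    qed
    with cont show ?thesis by blast
  qed
  hence "\<forall>n::nat. \<exists>p. continuous_on {0..a} p \<and> (\<forall>x\<in>{0..a}. dist (p x) (RL_integral \<alpha> h x) < inverse (real (Suc n)))"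
    by simp
  then obtain p where p: "\<And>n::nat. continuous_on {0..a} (p n)"
    "\<And>n x. x \<in> {0..a} \<Longrightarrow> dist (p n x) (RL_integral \<alpha> h x) < inverse (real (Suc n))" by metis
  have "uniform_limit {0..a} p (RL_integral \<alpha> h) sequentially"
  proof (rule uniform_limitI)
    fix e :: real assume "e > 0"
    then obtain N where N: "inverse (real (Suc N)) < e" using reals_Archimedean by blast
    have "\<forall>x\<in>{0..a}. dist (p n x) (RL_integral \<alpha> h x) < e" if "n \<ge> N" for n
    proof
      fix x assume "x \<in> {0..a}"
      from p(2)[OF this, of n] have "dist (p n x) (RL_integral \<alpha> h x) < inverse (real (Suc n))" .
      also have "\<dots> \<le> inverse (real (Suc N))" using that by (intro le_imp_inverse_le) auto
      finally show "dist (p n x) (RL_integral \<alpha> h x) < e" using N by simp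
    qed
    then show "\<forall>\<^sub>F n in sequentially. \<forall>x\<in>{0..a}. dist (p n x) (RL_integral \<alpha> h x) < e"
      using eventually_sequentially by blast
  qed
  then show ?thesis by (rule uniform_limit_theorem[rotated]) (auto simp: p)
qed

section \<open>Abel's identity on monomials and its extension by density\<close>

lemma Gamma_real_nonzero: "0 < x \<Longrightarrow> Gamma x \<noteq> 0" for x :: real
  using Gamma_real_pos[of x] by linarith

text \<open>Two applications of the power rule produce two Beta factors. Written with
  \<open>Gamma\<close>, they share \<open>Gamma (n + 2 - \<alpha>)\<close>, which cancels, and the
  quotient of \<open>Gamma (n + 1)\<close> by \<open>Gamma (n + 2)\<close> leaves
  \<open>1 / Suc n\<close>.\<close>

lemma Abel_identity_power:
  assumes "0 < \<alpha>" "\<alpha> < 1" "0 \<le> x"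
  shows "RL_integral (1 - \<alpha>) (RL_integral \<alpha> (\<lambda>t. t ^ n)) x =
    Gamma \<alpha> * Gamma (1 - \<alpha>) * (x ^ Suc n / real (Suc n))"
proof -
  have "RL_integral (1 - \<alpha>) (RL_integral \<alpha> (\<lambda>t. t ^ n)) x =
      RL_integral (1 - \<alpha>) (\<lambda>t. Beta (real n + 1) (1 - \<alpha>) * t powr (real n + 1 - \<alpha>)) x"
    using assms by (intro RL_integral_cong RL_integral_power) auto
  also have "\<dots> = Beta (real n + 1) (1 - \<alpha>) * (Beta (real n + 1 - \<alpha> + 1) (1 - (1 - \<alpha>))
      * x powr (real n + 1 - \<alpha> + 1 - (1 - \<alpha>)))"
    using assms by (simp only: RL_integral_cmult) (subst RL_integral_powr, auto)
  also have "\<dots> = (Beta (real n + 1) (1 - \<alpha>) * Beta (real n + 2 - \<alpha>) \<alpha>) * x powr real (Suc n)"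
    by (simp add: algebra_simps)
  also have "x powr real (Suc n) = x ^ Suc n" using assms by (intro powr_realpow') auto
  also have "Beta (real n + 1) (1 - \<alpha>) * Beta (real n + 2 - \<alpha>) \<alpha> = Gamma \<alpha> * Gamma (1 - \<alpha>) / real (Suc n)"
  proof -
    have nz: "Gamma (real n + 2 - \<alpha>) \<noteq> 0" "Gamma (real n + 1) \<noteq> 0" using assms by (auto intro!: Gamma_real_nonzero)
    have "Gamma (real n + 2) = real (Suc n) * Gamma (real n + 1)"
      using Gamma_plus1[of "real n + 1"] by (simp add: nonpos_Ints_def add_ac)
    moreover have "real n + 1 + (1 - \<alpha>) = real n + 2 - \<alpha>" "real n + 2 - \<alpha> + \<alpha> = real n + 2"
      by simp_all
    \<comment> \<open>The pattern of the two Beta factors: \<open>u\<close> is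
      \<open>Gamma (n + 1)\<close>, \<open>v\<close> is \<open>Gamma (n + 2 - \<alpha>)\<close>,
      \<open>w\<close> is \<open>Gamma (1 - \<alpha>)\<close>, \<open>z\<close> is
      \<open>Gamma \<alpha>\<close> and \<open>k\<close> is \<open>Suc n\<close>.\<close>
    moreover have "(u * w / v) * (v * z / (k * u)) = z * w / k" if "u \<noteq> 0" "v \<noteq> 0" for u v w z k :: real
      using that by simp
    ultimately show ?thesis
      unfolding Beta_def using nz by metis
  qed
  finally show ?thesis by simp
qed

text \<open>Both sides are linear in \<open>h\<close> and continuous for the sup norm on
  \<open>[0,x]\<close>, and they agree on monomials; polynomials are dense.\<close>

theorem Abel_identity:
  assumes "0 < \<alpha>" "\<alpha> < 1" "0 \<le> x" "continuous_on {0..x} h"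
  shows "RL_integral (1 - \<alpha>) (RL_integral \<alpha> h) x = Gamma \<alpha> * Gamma (1 - \<alpha>) * integral {0..x} h"
proof -
  \<comment> \<open>\<open>A\<close> is the mass of the inner kernel and \<open>B\<close> that of
    the outer one.\<close>
  define A B where "A = x powr (1 - \<alpha>) / (1 - \<alpha>)" and "B = x powr \<alpha> / \<alpha>"
  define G where "G = Gamma \<alpha> * Gamma (1 - \<alpha>)"
  have nonneg: "A \<ge> 0" "B \<ge> 0" "G \<ge> 0" using assms by (auto simp: A_def B_def G_def)
  have cont: "continuous_on {0..x} (RL_integral \<alpha> k)" if "continuous_on {0..x} k" for k
    using that assms by (intro continuous_on_RL_integral) auto
  have "\<bar>RL_integral (1 - \<alpha>) (RL_integral \<alpha> h) x - G * integral {0..x} h\<bar> \<le> 0 + e" if "e > 0" for e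
  proof -
    \<comment> \<open>Replacing \<open>h\<close> by a polynomial within \<open>d\<close> costs at
      most \<open>d * A * B\<close> on the left and \<open>G * d * x\<close> on the right; the
      summand \<open>1\<close> keeps the denominator positive.\<close>
    define d where "d = e / (A * B + G * x + 1)"
    have d: "d > 0" unfolding d_def using \<open>e > 0\<close> nonneg assms by (intro divide_pos_pos add_nonneg_pos) auto
    obtain c n where c: "\<And>t. t \<in> {0..x} \<Longrightarrow> \<bar>h t - (\<Sum>i\<le>n. c i * t ^ i)\<bar> < d"
      using polynomial_approximation[OF assms(4) d] by auto
    define P where "P = (\<lambda>t. \<Sum>i\<le>n. c i * t ^ i)"
    have P: "continuous_on S P" for S unfolding P_def by (intro continuous_intros)
    have "RL_integral (1 - \<alpha>) (RL_integral \<alpha> P) x =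
        RL_integral (1 - \<alpha>) (\<lambda>y. \<Sum>i\<le>n. c i * RL_integral \<alpha> (\<lambda>t. t ^ i) y) x"
    proof (rule RL_integral_cong)
      fix y assume "y \<in> {0..x}"
      then show "RL_integral \<alpha> P y = (\<Sum>i\<le>n. c i * RL_integral \<alpha> (\<lambda>t. t ^ i) y)"
        using assms unfolding P_def
        by (subst RL_integral_sum) (auto simp: RL_integral_cmult intro!: continuous_intros)
    qed
    also have "\<dots> = (\<Sum>i\<le>n. c i * (G * (x ^ Suc i / real (Suc i))))"
      unfolding G_def using assms
      by (subst RL_integral_sum)
         (auto simp: RL_integral_cmult Abel_identity_power intro!: continuous_intros cont)
    also have "\<dots> = G * (\<Sum>i\<le>n. c i * (x ^ Suc i / real (Suc i)))"
      by (simp add: sum_distrib_left mult_ac)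
    also have "(\<Sum>i\<le>n. c i * (x ^ Suc i / real (Suc i))) = integral {0..x} P"
    proof -
      have "((\<lambda>t. t ^ i) has_integral x ^ Suc i / real (Suc i)) {0..x}" for i
      proof -
        have "((\<lambda>t. t ^ i) has_integral x ^ Suc i / real (Suc i) - 0 ^ Suc i / real (Suc i)) {0..x}"
        proof (rule fundamental_theorem_of_calculus[OF assms(3)])
          fix t :: real
          have "((\<lambda>t. t ^ Suc i / real (Suc i)) has_real_derivative t ^ i) (at t within {0..x})"
            by (rule DERIV_cong[OF DERIV_cdivide[OF DERIV_pow]]) simp
          then show "((\<lambda>t. t ^ Suc i / real (Suc i)) has_vector_derivative t ^ i) (at t within {0..x})"
            by (simp only: has_real_derivative_iff_has_vector_derivative)
        qed
        then show ?thesis by simp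
      qed
      then have "(P has_integral (\<Sum>i\<le>n. c i * (x ^ Suc i / real (Suc i)))) {0..x}"
        unfolding P_def by (intro has_integral_sum has_integral_mult_right) auto
      then show ?thesis by (simp add: integral_unique)
    qed
    finally have P_eq: "RL_integral (1 - \<alpha>) (RL_integral \<alpha> P) x = G * integral {0..x} P" .
    have inner: "\<bar>RL_integral \<alpha> h y - RL_integral \<alpha> P y\<bar> \<le> d * A" if y: "y \<in> {0..x}" for y
    proof -
      have hy: "continuous_on {0..y} h" using y by (intro continuous_on_subset[OF assms(4)]) auto
      have "\<bar>RL_integral \<alpha> (\<lambda>t. h t - P t) y\<bar> \<le> d * (y powr (1 - \<alpha>) / (1 - \<alpha>))"
        using y c assms by (intro RL_integral_bound continuous_on_diff hy P) (auto simp: P_def intro: less_imp_le)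
      also have "\<dots> \<le> d * A"
        using y assms d by (intro mult_left_mono) (auto simp: A_def intro!: divide_right_mono powr_mono2)
      finally show ?thesis using RL_integral_diff[OF assms(2) _ hy P] y by simp
    qed
    have "\<bar>RL_integral (1 - \<alpha>) (\<lambda>y. RL_integral \<alpha> h y - RL_integral \<alpha> P y) x\<bar> \<le>
        d * A * (x powr (1 - (1 - \<alpha>)) / (1 - (1 - \<alpha>)))"
      using assms inner by (intro RL_integral_bound continuous_on_diff cont P) auto
    then have 1: "\<bar>RL_integral (1 - \<alpha>) (RL_integral \<alpha> h) x - RL_integral (1 - \<alpha>) (RL_integral \<alpha> P) x\<bar> \<le> d * A * B"
      using assms by (subst (asm) RL_integral_diff) (auto intro: cont P simp: B_def)
    have "norm (integral {0..x} (\<lambda>t. h t - P t)) \<le> integral {0..x} (\<lambda>t. d)"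
      using c by (intro integral_norm_bound_integral integrable_continuous_real continuous_on_diff assms P)
        (auto simp: P_def intro: less_imp_le)
    then have "\<bar>integral {0..x} h - integral {0..x} P\<bar> \<le> d * x"
      using assms by (subst (asm) integral_diff) (auto intro!: integrable_continuous_real P simp: mult.commute)
    then have "G * \<bar>integral {0..x} h - integral {0..x} P\<bar> \<le> G * (d * x)"
      using nonneg by (intro mult_left_mono)
    then have 2: "\<bar>G * integral {0..x} h - G * integral {0..x} P\<bar> \<le> G * (d * x)"
      using nonneg by (simp add: abs_mult flip: right_diff_distrib)
    have "d * A * B + G * (d * x) = d * (A * B + G * x)" by (simp add: algebra_simps)
    also have "\<dots> \<le> d * (A * B + G * x + 1)" using d by (intro mult_left_mono) auto
    also have "\<dots> = e" unfolding d_def using nonneg assms add_nonneg_pos[of "A * B + G * x" 1] by simp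
    finally show ?thesis using 1 2 P_eq by linarith
  qed
  then have "\<bar>RL_integral (1 - \<alpha>) (RL_integral \<alpha> h) x - G * integral {0..x} h\<bar> \<le> 0"
    by (rule field_le_epsilon)
  then show ?thesis by (simp add: G_def)
qed

section \<open>Injectivity of the fractional integral\<close>

lemma continuous_eq_0_if_integral_eq_0:
  fixes h :: "real \<Rightarrow> real"
  assumes "a > 0" "continuous_on {0..a} h" "\<And>x. x \<in> {0..a} \<Longrightarrow> integral {0..x} h = 0" "x \<in> {0..a}"
  shows "h x = 0"
proof -
  have "((\<lambda>u. integral {0..u} h) has_vector_derivative h x) (at x within {0..a})"
    by (rule integral_has_vector_derivative[OF assms(2,4)])
  moreover have "((\<lambda>u. integral {0..u} h) has_vector_derivative 0) (at x within {0..a})"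
    by (rule has_vector_derivative_transform[of _ _ _ "\<lambda>_. 0"]) (use assms in auto)
  ultimately show ?thesis
    using assms vector_derivative_unique_within_closed_interval[of 0 a x] by auto
qed

text \<open>Applying the integral with exponent \<open>1 - \<alpha>\<close> turns the hypothesis, by
  Abel's identity, into equality of ordinary primitives, which can be differentiated.\<close>

theorem RL_integral_inject:
  assumes "0 < \<alpha>" "\<alpha> < 1" "0 < a" "continuous_on {0..a} h" "continuous_on {0..a} k"
    and eq: "\<And>x. x \<in> {0..a} \<Longrightarrow> RL_integral \<alpha> h x = RL_integral \<alpha> k x"
    and "x \<in> {0..a}"
  shows "h x = k x"
proof -
  have sub: "continuous_on {0..y} h" "continuous_on {0..y} k" if "y \<in> {0..a}" for y
    using that by (auto intro: continuous_on_subset[OF assms(4)] continuous_on_subset[OF assms(5)])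
  have "integral {0..y} (\<lambda>t. h t - k t) = 0" if y: "y \<in> {0..a}" for y
  proof -
    have "RL_integral (1 - \<alpha>) (RL_integral \<alpha> h) y = RL_integral (1 - \<alpha>) (RL_integral \<alpha> k) y"
      using y by (intro RL_integral_cong eq) auto
    moreover have "Gamma \<alpha> \<noteq> 0" "Gamma (1 - \<alpha>) \<noteq> 0"
      using assms by (auto intro!: Gamma_real_nonzero)
    ultimately have "integral {0..y} h = integral {0..y} k"
      using y assms by (simp add: Abel_identity sub)
    then show ?thesis using sub[OF y] by (simp add: integral_diff integrable_continuous_real)
  qed
  from continuous_eq_0_if_integral_eq_0[OF assms(3) _ this assms(7)] assms(4,5)
  show ?thesis by (auto intro: continuous_on_diff)
qed

section \<open>Osgood's criterion\<close>

text \<open>Jensen's inequality for the power \<open>p\<close> and the measure \<open>k t dt\<close>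
  of mass \<open>I\<close>. It follows by integrating Young's inequality for \<open>y t\<close>
  against \<open>m powr (p - 1)\<close>, where \<open>m\<close> is the weighted mean of
  \<open>y\<close>.\<close>

lemma weighted_power_mean:
  fixes y k :: "real \<Rightarrow> real" and a b p :: real
  assumes "p > 1" and y: "continuous_on {a..b} y" "\<And>t. t \<in> {a..b} \<Longrightarrow> 0 \<le> y t"
    and k: "(k has_integral I) {a..b}" "\<And>t. t \<in> {a..b} \<Longrightarrow> 0 \<le> k t" and "I > 0"
  shows "I * (integral {a..b} (\<lambda>t. y t * k t) / I) powr p \<le> integral {a..b} (\<lambda>t. y t powr p * k t)"
proof -
  define m where "m = integral {a..b} (\<lambda>t. y t * k t) / I"
  \<comment> \<open>The conjugate exponent of \<open>p\<close>, so that
    \<open>(m powr (p - 1)) powr q\<close> is \<open>m powr p\<close>.\<close>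
  define q where "q = p / (p - 1)"
  have q: "q > 1" "1 / p + 1 / q = 1" and pq: "(p - 1) * q = p"
    using \<open>p > 1\<close> by (auto simp: q_def field_simps)
  have k_int: "k integrable_on {a..b}" using k by blast
  have yk: "(\<lambda>t. y t * k t) integrable_on {a..b}"
    by (intro continuous_mult_integrable y k_int k)
  have ypk: "(\<lambda>t. y t powr p * k t) integrable_on {a..b}"
    using y \<open>p > 1\<close>
    by (intro continuous_mult_integrable k_int k continuous_on_powr' continuous_intros) auto
  have m0: "m \<ge> 0" unfolding m_def using y k \<open>I > 0\<close>
    by (intro divide_nonneg_pos integral_nonneg yk) auto
  have mm: "m powr (p - 1) * m = m powr p"
    using m0 \<open>p > 1\<close> powr_mult_base[of m "p - 1"] by (simp add: mult.commute)
  have "integral {a..b} (\<lambda>t. m powr (p - 1) * (y t * k t)) \<le>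
      integral {a..b} (\<lambda>t. y t powr p * k t / p + m powr p / q * k t)"
  proof (rule integral_le)
    fix t assume t: "t \<in> {a..b}"
    have "y t * m powr (p - 1) \<le> y t powr p / p + (m powr (p - 1)) powr q / q"
      using Youngs_inequality[OF \<open>p > 1\<close> q(1,2)] y(2)[OF t] by simp
    then have "y t * m powr (p - 1) * k t \<le> (y t powr p / p + m powr p / q) * k t"
      using k(2)[OF t] by (intro mult_right_mono) (auto simp: powr_powr pq)
    then show "m powr (p - 1) * (y t * k t) \<le> y t powr p * k t / p + m powr p / q * k t"
      by (simp add: algebra_simps)
  qed (use yk ypk k_int in \<open>auto intro!: integrable_add integrable_on_divide integrable_on_mult_right\<close>)
  also have "\<dots> = integral {a..b} (\<lambda>t. y t powr p * k t) / p + m powr p / q * I"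
    using ypk k_int integral_unique[OF k(1)]
    by (subst integral_add) (auto intro: integrable_on_divide integrable_on_mult_right)
  also have "integral {a..b} (\<lambda>t. m powr (p - 1) * (y t * k t)) = m powr (p - 1) * (m * I)"
    using \<open>I > 0\<close> by (simp add: m_def)
  also have "\<dots> = m powr p * I" by (simp flip: mm)
  finally have "m powr p * I * (1 - 1 / q) \<le> integral {a..b} (\<lambda>t. y t powr p * k t) / p"
    by (simp add: algebra_simps)
  also have "1 - 1 / q = 1 / p" using q(2) by simp
  finally show ?thesis using \<open>p > 1\<close> unfolding m_def[symmetric] by (simp add: divide_simps mult.commute)
qed

section \<open>Integrals against the weight \<open>1 / t powr \<beta>\<close>\<close>

lemma has_integral_weight:
  fixes \<beta> x :: real
  assumes "\<beta> < 1" "0 \<le> x"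
  shows "((\<lambda>t. 1 / t powr \<beta>) has_integral x powr (1 - \<beta>) / (1 - \<beta>)) {0..x}"
  using has_integral_powr_from_0[of "-\<beta>" x] assms by (simp add: powr_minus_divide)

lemma weighted_integrable:
  fixes \<beta> x :: real
  assumes "\<beta> < 1" "0 \<le> x" "continuous_on {0..x} \<phi>"
  shows "(\<lambda>t. \<phi> t / t powr \<beta>) integrable_on {0..x}"
proof -
  have "(\<lambda>t. \<phi> t * (1 / t powr \<beta>)) integrable_on {0..x}"
    using has_integral_weight[OF assms(1,2)] by (intro continuous_mult_integrable assms(3)) auto
  then show ?thesis by simp
qed

text \<open>The point \<open>0\<close>, where the weight may be singular, is left out; elsewhere the
  integrand is continuous and the fundamental theorem applies pointwise.\<close>

lemma weighted_integral_has_derivative: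
  fixes \<beta> x :: real
  assumes "\<beta> < 1" "continuous_on {0..a} \<phi>" "x \<in> {0<..a}"
  shows "((\<lambda>x. integral {0..x} (\<lambda>t. \<phi> t / t powr \<beta>)) has_real_derivative \<phi> x / x powr \<beta>)
    (at x within {0..a})"
proof -
  have "continuous (at x within {0..a}) (\<lambda>t. \<phi> t / t powr \<beta>)"
    using assms continuous_on_eq_continuous_within[of "{0..a}" \<phi>]
    unfolding continuous_within by (intro tendsto_intros) auto
  then show ?thesis
    using integral_has_vector_derivative_continuous_at[of "\<lambda>t. \<phi> t / t powr \<beta>" 0 a x "{}"]
      weighted_integrable[OF assms(1) _ assms(2)] assms(3)
    by (simp add: has_real_derivative_iff_has_vector_derivative)
qed

section \<open>Vanishing of functions controlled by an Osgood modulus\<close>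

text \<open>If \<open>G\<close> is a primitive of \<open>1 / g\<close>, then \<open>G (W x)\<close>
  grows no faster than \<open>S x\<close>. So the integral of \<open>1 / g\<close> from
  \<open>\<epsilon>\<close> to \<open>W z\<close> stays below \<open>S z\<close> as
  \<open>\<epsilon>\<close> tends to \<open>0\<close>, which contradicts divergence unless
  \<open>W z = 0\<close>.\<close>

lemma osgood_comparison:
  assumes g: "continuous_on {0..} g" "\<And>u. u \<ge> 0 \<Longrightarrow> g u \<ge> 0" "mono_on {0..} g" "osgood g"
    and W: "continuous_on {0..a} W" "W 0 = 0" "mono_on {0..a} W"
    and S: "continuous_on {0..a} S" "\<And>x. x \<in> {0..a} \<Longrightarrow> 0 \<le> S x"
    and W': "\<And>x. x \<in> {0<..<a} \<Longrightarrow> (W has_real_derivative W' x) (at x)"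
    and S': "\<And>x. x \<in> {0<..<a} \<Longrightarrow> (S has_real_derivative S' x) (at x)"
    and le: "\<And>x. x \<in> {0<..<a} \<Longrightarrow> W' x \<le> S' x * g (W x)"
    and z: "z \<in> {0..a}"
  shows "W z = 0"
proof (rule ccontr)
  assume "W z \<noteq> 0"
  have Wmono: "W x \<le> W y" if "0 \<le> x" "x \<le> y" "y \<le> a" for x y
    using W(3) that by (auto simp: mono_on_def)
  define \<gamma> where "\<gamma> = W z"
  have "\<gamma> > 0" using Wmono[of 0 z] z W(2) \<open>W z \<noteq> 0\<close> by (auto simp: \<gamma>_def)
  have level: "\<exists>y\<in>{0..z}. W y = \<epsilon>" if "0 < \<epsilon>" "\<epsilon> \<le> \<gamma>" for \<epsilon>
    using IVT'[of W 0 \<epsilon> z] that z W(2) continuous_on_subset[OF W(1)]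
    by (force simp: \<gamma>_def)
  \<comment> \<open>If \<open>g \<epsilon> = 0\<close>, monotonicity makes \<open>g\<close> vanish
    on \<open>[0,\<epsilon>]\<close>, so \<open>W\<close> has nonpositive derivative while its
    values stay there and cannot leave \<open>0\<close>.\<close>
  have g_pos: "g \<epsilon> > 0" if "0 < \<epsilon>" for \<epsilon>
  proof (rule ccontr)
    assume "\<not> g \<epsilon> > 0"
    with g(2)[of \<epsilon>] that have "g \<epsilon> = 0" by simp
    \<comment> \<open>A level that \<open>W\<close> attains, being at most \<open>\<gamma>\<close>,
      and below which \<open>g\<close> vanishes, being at most \<open>\<epsilon>\<close>.\<close>
    define \<delta> where "\<delta> = min \<epsilon> \<gamma>"
    have \<delta>: "\<delta> > 0" "\<delta> \<le> \<gamma>" using that \<open>\<gamma> > 0\<close> by (auto simp: \<delta>_def)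
    then obtain y where y: "y \<in> {0..z}" "W y = \<delta>" using level by blast
    have "W y \<le> W 0"
    proof (rule DERIV_nonpos_imp_decreasing_open[of 0 y W])
      fix x assume x: "0 < x" "x < y"
      have "0 \<le> W x" "W x \<le> \<delta>" using Wmono[of 0 x] Wmono[of x y] x y z W(2) by auto
      then have "g (W x) \<le> g \<epsilon>" using g(3) that by (auto simp: mono_on_def \<delta>_def)
      with g(2)[OF \<open>0 \<le> W x\<close>] \<open>g \<epsilon> = 0\<close> have "g (W x) = 0" by simp
      then show "\<exists>d. (W has_real_derivative d) (at x) \<and> d \<le> 0"
        using le[of x] W'[of x] x y z by fastforce
    qed (use y z in \<open>auto intro: continuous_on_subset[OF W(1)]\<close>)
    with y \<delta> W(2) show False by simp
  qed
  have bound: "(\<integral>\<^sup>+u\<in>{\<epsilon>..\<gamma>}. (1 / ennreal (g u)) \<partial>lborel) \<le> ennreal (S z)" if \<epsilon>: "0 < \<epsilon>" "\<epsilon> < \<gamma>" for \<epsilon>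
  proof -
    obtain y where y: "y \<in> {0..z}" "W y = \<epsilon>" using level \<epsilon> by (meson less_imp_le)
    have cont: "continuous_on A (\<lambda>u. 1 / g u)" if "A \<subseteq> {0<..}" for A
      using that g_pos by (intro continuous_intros continuous_on_subset[OF g(1)]) force+
    \<comment> \<open>Starting at \<open>\<epsilon>/2\<close> puts \<open>\<epsilon>\<close> in the
      interior, so that \<open>G\<close> has two-sided derivatives on
      \<open>[\<epsilon>,\<gamma>]\<close>.\<close>
    define G where "G w = integral {\<epsilon>/2..w} (\<lambda>u. 1 / g u)" for w
    have G': "(G has_real_derivative 1 / g w) (at w)" if "w \<in> {\<epsilon>..\<gamma>}" for w
    proof -
      have "(G has_real_derivative 1 / g w) (at w within {\<epsilon>/2..\<gamma>+1})"
        unfolding G_def[abs_def] using \<epsilon> that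
        by (intro integral_has_real_derivative cont) auto
      moreover have "w \<in> interior {\<epsilon>/2..\<gamma>+1}" using \<epsilon> that by simp
      ultimately show ?thesis using at_within_interior by metis
    qed
    have WI: "W x \<in> {\<epsilon>..\<gamma>}" if "x \<in> {y..z}" for x
      using Wmono[of y x] Wmono[of x z] that y z by (auto simp: \<gamma>_def)
    \<comment> \<open>\<open>S - G \<circ> W\<close> is nondecreasing from \<open>y\<close>, where
      \<open>W\<close> equals \<open>\<epsilon>\<close>, to \<open>z\<close>, where it equals
      \<open>\<gamma>\<close>.\<close>
    have "S y - G (W y) \<le> S z - G (W z)"
    proof (rule DERIV_nonneg_imp_increasing_open[of y z "\<lambda>x. S x - G (W x)"])
      show "y \<le> z" using y by simp
      have "continuous_on {\<epsilon>..\<gamma>} G"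
        using G' by (intro DERIV_continuous_on) (auto intro: has_field_derivative_at_within)
      moreover have "continuous_on {y..z} W"
        using y z by (intro continuous_on_subset[OF W(1)]) auto
      ultimately have "continuous_on {y..z} (\<lambda>x. G (W x))"
        by (rule continuous_on_compose2) (use WI in blast)
      moreover have "continuous_on {y..z} S"
        using y z by (intro continuous_on_subset[OF S(1)]) auto
      ultimately show "continuous_on {y..z} (\<lambda>x. S x - G (W x))"
        by (intro continuous_intros)
      fix x assume x: "y < x" "x < z"
      then have xa: "x \<in> {0<..<a}" using y z by auto
      have "((\<lambda>x. G (W x)) has_real_derivative 1 / g (W x) * W' x) (at x)"
        using DERIV_chain2[OF G' W'[OF xa]] WI[of x] x by auto
      with S'[OF xa] have "((\<lambda>x. S x - G (W x)) has_real_derivative S' x - 1 / g (W x) * W' x) (at x)"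
        by (rule DERIV_diff)
      moreover have "g (W x) > 0" using WI[of x] x \<epsilon> by (intro g_pos) auto
      with le[OF xa] have "S' x - 1 / g (W x) * W' x \<ge> 0" by (simp add: field_simps)
      ultimately show "\<exists>d. ((\<lambda>x. S x - G (W x)) has_real_derivative d) (at x) \<and> 0 \<le> d" by blast
    qed
    moreover have "S y \<ge> 0" using y z by (intro S) auto
    ultimately have le_S: "G \<gamma> - G \<epsilon> \<le> S z" using y by (simp add: \<gamma>_def)
    have "((\<lambda>u. 1 / g u) has_integral G \<gamma> - G \<epsilon>) {\<epsilon>..\<gamma>}"
      using \<epsilon> G' by (intro fundamental_theorem_of_calculus)
        (auto simp flip: has_real_derivative_iff_has_vector_derivative intro: has_field_derivative_at_within)
    then have "(\<integral>\<^sup>+u. ennreal (1 / g u) * indicator {\<epsilon>..\<gamma>} u \<partial>lborel) = ennreal (G \<gamma> - G \<epsilon>)"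
      by (rule nn_integral_has_integral_lebesgue'[rotated]) (use g_pos \<epsilon> in \<open>force intro: less_imp_le\<close>)
    also have "(\<lambda>u. ennreal (1 / g u) * indicator {\<epsilon>..\<gamma>} u) = (\<lambda>u. (1 / ennreal (g u)) * indicator {\<epsilon>..\<gamma>} u)"
      using \<epsilon> g_pos by (auto simp: fun_eq_iff indicator_def divide_ennreal[symmetric] simp flip: ennreal_1)
    finally show ?thesis using le_S by (simp add: ennreal_leI)
  qed
  have lim: "((\<lambda>\<epsilon>. \<integral>\<^sup>+u\<in>{\<epsilon>..\<gamma>}. (1 / ennreal (g u)) \<partial>lborel) \<longlongrightarrow> top) (at_right 0)"
    using g(4) \<open>\<gamma> > 0\<close> unfolding osgood_def by blast
  have "\<forall>\<^sub>F \<epsilon> in at_right 0. (\<integral>\<^sup>+u\<in>{\<epsilon>..\<gamma>}. (1 / ennreal (g u)) \<partial>lborel) \<le> ennreal (S z)"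
    using bound \<open>\<gamma> > 0\<close>
    by (intro eventually_at_rightI[of 0 \<gamma>]) auto
  from tendsto_upperbound[OF lim this] have "top \<le> ennreal (S z)" by simp
  then show False by (simp add: top_unique)
qed

text \<open>The right-hand side, called \<open>W\<close>, dominates \<open>u\<close>, so
  monotonicity of \<open>g\<close> gives \<open>W' x \<le> K / x powr \<beta> * g (W x)\<close>. The
  comparison applies with \<open>S\<close> the primitive of \<open>K / x powr \<beta>\<close>, which
  is finite since \<open>\<beta> < 1\<close>.\<close>

lemma osgood_integral_inequality:
  assumes g: "continuous_on {0..} g" "\<And>u. u \<ge> 0 \<Longrightarrow> g u \<ge> 0" "mono_on {0..} g" "osgood g"
    and "\<beta> < 1" "K \<ge> 0"
    and u: "continuous_on {0..a} u" "\<And>x. x \<in> {0..a} \<Longrightarrow> 0 \<le> u x"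
    and le: "\<And>x. x \<in> {0..a} \<Longrightarrow> u x \<le> K * integral {0..x} (\<lambda>t. g (u t) / t powr \<beta>)"
    and z: "z \<in> {0..a}"
  shows "u z = 0"
proof -
  define W where "W x = K * integral {0..x} (\<lambda>t. g (u t) / t powr \<beta>)" for x
  define S where "S x = K * (x powr (1 - \<beta>) / (1 - \<beta>))" for x
  have gu: "continuous_on {0..a} (\<lambda>t. g (u t))"
    using u by (intro continuous_on_compose2[OF g(1) u(1)]) auto
  have int: "(\<lambda>t. g (u t) / t powr \<beta>) integrable_on {0..x}" if "x \<in> {0..a}" for x
    using that by (intro weighted_integrable \<open>\<beta> < 1\<close> continuous_on_subset[OF gu]) auto
  have "W z = 0"
  proof (rule osgood_comparison[OF g, of a W S "\<lambda>x. K * (g (u x) / x powr \<beta>)" "\<lambda>x. K / x powr \<beta>"])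
    show "continuous_on {0..a} W" unfolding W_def
      using int[of a] z by (intro continuous_intros indefinite_integral_continuous_1) auto
    show "W 0 = 0" by (simp add: W_def)
    show mono: "mono_on {0..a} W" unfolding W_def using g(2) u(2) \<open>K \<ge> 0\<close>
      by (intro mono_onI mult_left_mono integral_subset_le int) auto
    show "continuous_on {0..a} S" unfolding S_def using \<open>\<beta> < 1\<close>
      by (intro continuous_intros continuous_on_powr') auto
    show "0 \<le> S x" for x unfolding S_def using \<open>\<beta> < 1\<close> \<open>K \<ge> 0\<close> by simp
    fix x assume x: "x \<in> {0<..<a}"
    then have "x \<in> interior {0..a}" by simp
    then have "at x within {0..a} = at x" by (rule at_within_interior)
    with weighted_integral_has_derivative[OF \<open>\<beta> < 1\<close> gu, of x] x
    have "((\<lambda>x. integral {0..x} (\<lambda>t. g (u t) / t powr \<beta>)) has_real_derivative g (u x) / x powr \<beta>) (at x)"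
      by simp
    then show "(W has_real_derivative K * (g (u x) / x powr \<beta>)) (at x)"
      unfolding W_def[abs_def] by (rule DERIV_cmult)
    have "((\<lambda>x. x powr (1 - \<beta>) / (1 - \<beta>)) has_real_derivative 1 / x powr \<beta>) (at x)"
      using x \<open>\<beta> < 1\<close> by (auto intro!: derivative_eq_intros simp: powr_minus_divide)
    from DERIV_cmult[OF this, of K] show "(S has_real_derivative K / x powr \<beta>) (at x)"
      unfolding S_def[abs_def] by simp
    have "g (u x) \<le> g (W x)"
      using le[of x] u(2)[of x] x by (intro mono_onD[OF g(3)]) (auto simp: W_def)
    then show "K * (g (u x) / x powr \<beta>) \<le> K / x powr \<beta> * g (W x)"
      using \<open>K \<ge> 0\<close> by (simp add: divide_right_mono mult_left_mono)
  qed (use z in auto)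
  then show ?thesis using le[OF z] u(2)[OF z] unfolding W_def by linarith
qed

section \<open>The weighted Volterra equation\<close>

text \<open>Gives one modulus of continuity for all integrands bounded by \<open>M\<close>. Both the
  equicontinuity of the delayed solutions and the vanishing of the delay error come from it.\<close>

lemma weighted_integral_diff_bound:
  fixes \<beta> x y M :: real
  assumes "\<beta> < 1" "continuous_on {0..a} \<phi>" "\<And>t. t \<in> {0..a} \<Longrightarrow> \<bar>\<phi> t\<bar> \<le> M"
    and "x \<in> {0..a}" "y \<in> {0..a}"
  shows "\<bar>integral {0..x} (\<lambda>t. \<phi> t / t powr \<beta>) - integral {0..y} (\<lambda>t. \<phi> t / t powr \<beta>)\<bar>
    \<le> M * \<bar>x powr (1 - \<beta>) / (1 - \<beta>) - y powr (1 - \<beta>) / (1 - \<beta>)\<bar>"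
proof -
  have *: "\<bar>integral {0..y} (\<lambda>t. \<phi> t / t powr \<beta>) - integral {0..x} (\<lambda>t. \<phi> t / t powr \<beta>)\<bar>
      \<le> M * (y powr (1 - \<beta>) / (1 - \<beta>) - x powr (1 - \<beta>) / (1 - \<beta>))"
    if "0 \<le> x" "x \<le> y" "y \<le> a" for x y
  proof -
    have i1: "(\<lambda>t. \<phi> t / t powr \<beta>) integrable_on {0..y}"
      using that by (intro weighted_integrable assms continuous_on_subset[OF assms(2)]) auto
    have w: "((\<lambda>t. 1 / t powr \<beta>) has_integral y powr (1 - \<beta>) / (1 - \<beta>)) {0..y}"
        "((\<lambda>t. 1 / t powr \<beta>) has_integral x powr (1 - \<beta>) / (1 - \<beta>)) {0..x}"
      using that by (auto intro: has_integral_weight assms(1))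
    have i2: "(\<lambda>t. 1 / t powr \<beta>) integrable_on {0..y}" using w by blast
    have "integral {0..y} (\<lambda>t. \<phi> t / t powr \<beta>) - integral {0..x} (\<lambda>t. \<phi> t / t powr \<beta>)
        = integral {x..y} (\<lambda>t. \<phi> t / t powr \<beta>)"
      using Henstock_Kurzweil_Integration.integral_combine[OF that(1,2) i1] by simp
    moreover have "norm (integral {x..y} (\<lambda>t. \<phi> t / t powr \<beta>)) \<le> integral {x..y} (\<lambda>t. M * (1 / t powr \<beta>))"
    proof (rule integral_norm_bound_integral)
      show "(\<lambda>t. \<phi> t / t powr \<beta>) integrable_on {x..y}"
        using that by (intro integrable_subinterval_real[OF i1]) auto
      show "(\<lambda>t. M * (1 / t powr \<beta>)) integrable_on {x..y}"
        using that by (intro integrable_on_mult_right integrable_subinterval_real[OF i2]) auto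
      fix t assume "t \<in> {x..y}"
      then show "norm (\<phi> t / t powr \<beta>) \<le> M * (1 / t powr \<beta>)"
        using assms(3)[of t] that by (simp add: divide_right_mono)
    qed
    moreover have "integral {x..y} (\<lambda>t. 1 / t powr \<beta>) =
        y powr (1 - \<beta>) / (1 - \<beta>) - x powr (1 - \<beta>) / (1 - \<beta>)"
      using Henstock_Kurzweil_Integration.integral_combine[OF that(1,2) i2]
        integral_unique[OF w(1)] integral_unique[OF w(2)] by linarith
    then have "integral {x..y} (\<lambda>t. M * (1 / t powr \<beta>)) =
        M * (y powr (1 - \<beta>) / (1 - \<beta>) - x powr (1 - \<beta>) / (1 - \<beta>))"
      by (subst integral_mult_right) simp
    ultimately show ?thesis by simp
  qed
  have M: "M \<ge> 0" using assms(3)[of x] assms(4) by force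
  show ?thesis
  proof (cases "x \<le> y")
    case True
    then have "M * (y powr (1 - \<beta>) / (1 - \<beta>) - x powr (1 - \<beta>) / (1 - \<beta>)) \<le>
        M * \<bar>x powr (1 - \<beta>) / (1 - \<beta>) - y powr (1 - \<beta>) / (1 - \<beta>)\<bar>"
      using M by (intro mult_left_mono) auto
    then show ?thesis using *[of x y] True assms(4,5) by auto
  next
    case False
    then have "M * (x powr (1 - \<beta>) / (1 - \<beta>) - y powr (1 - \<beta>) / (1 - \<beta>)) \<le>
        M * \<bar>x powr (1 - \<beta>) / (1 - \<beta>) - y powr (1 - \<beta>) / (1 - \<beta>)\<bar>"
      using M by (intro mult_left_mono) auto
    then show ?thesis using *[of y x] False assms(4,5) by auto
  qed
qed

text \<open>The exponential adapted to the weight: its derivative is itself times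
  \<open>c * (1 - \<beta>) / t powr \<beta>\<close>. It supplies the majorant \<open>bnd\<close> of
  the iterates.\<close>

lemma weighted_integral_exp:
  fixes \<beta> c x :: real
  assumes "\<beta> < 1" "0 \<le> x"
  shows "((\<lambda>t. c * (1 - \<beta>) * exp (c * t powr (1 - \<beta>)) / t powr \<beta>) has_integral
    exp (c * x powr (1 - \<beta>)) - 1) {0..x}"
proof -
  have "((\<lambda>t. c * (1 - \<beta>) * exp (c * t powr (1 - \<beta>)) / t powr \<beta>) has_integral
      exp (c * x powr (1 - \<beta>)) - exp (c * 0 powr (1 - \<beta>))) {0..x}"
  proof (rule fundamental_theorem_of_calculus_interior[OF assms(2)])
    show "continuous_on {0..x} (\<lambda>t. exp (c * t powr (1 - \<beta>)))"
      using assms by (intro continuous_intros continuous_on_powr') auto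
    fix t assume "t \<in> {0<..<x}"
    then have "((\<lambda>t. exp (c * t powr (1 - \<beta>))) has_real_derivative
        c * (1 - \<beta>) * exp (c * t powr (1 - \<beta>)) / t powr \<beta>) (at t)"
      by (auto intro!: derivative_eq_intros simp: powr_minus_divide)
    then show "((\<lambda>t. exp (c * t powr (1 - \<beta>))) has_vector_derivative
        c * (1 - \<beta>) * exp (c * t powr (1 - \<beta>)) / t powr \<beta>) (at t)"
      by (simp only: has_real_derivative_iff_has_vector_derivative)
  qed
  then show ?thesis by simp
qed

section \<open>The operators of the integral equation and the iteration with delay\<close>

locale fractional_volterra =
  fixes \<beta> a b :: real and F :: "real \<times> real \<times> real \<Rightarrow> real"
  assumes \<beta>: "0 < \<beta>" "\<beta> < 1" and a: "0 < a"
    and F_cont: "continuous_on ({0..a} \<times> UNIV \<times> UNIV) F"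
begin

definition J :: "(real \<Rightarrow> real) \<Rightarrow> real \<Rightarrow> real" where
  "J v x = RL_integral (1 - \<beta>) v x / Gamma \<beta>"

definition N :: "(real \<Rightarrow> real) \<Rightarrow> real \<Rightarrow> real" where
  "N v t = F (t, J v t, v t)"

text \<open>The value at \<open>a\<close> of \<open>J\<close> applied to the constant
  \<open>1\<close>, which bounds the sup norm of \<open>J\<close> on \<open>[0,a]\<close>.\<close>

definition J_norm :: real where "J_norm = a powr \<beta> / \<beta> / Gamma \<beta>"

lemma Gamma_\<beta>: "Gamma \<beta> > 0" using \<beta> by (intro Gamma_real_pos)

lemma J_norm_nonneg: "J_norm \<ge> 0" using \<beta> Gamma_\<beta> by (simp add: J_norm_def)

lemma continuous_on_J:
  assumes "continuous_on {0..x} v" "0 \<le> x"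
  shows "continuous_on {0..x} (J v)"
  unfolding J_def using \<beta>
  by (intro continuous_intros continuous_on_RL_integral assms) (auto simp: Gamma_real_nonzero)

lemma J_bound:
  assumes "continuous_on {0..x} v" "x \<in> {0..a}" "\<And>t. t \<in> {0..x} \<Longrightarrow> \<bar>v t\<bar> \<le> B"
  shows "\<bar>J v x\<bar> \<le> J_norm * B"
proof -
  have "B \<ge> 0" using assms(3)[of 0] assms(2) by force
  have "\<bar>RL_integral (1 - \<beta>) v x\<bar> \<le> B * (x powr (1 - (1 - \<beta>)) / (1 - (1 - \<beta>)))"
    using \<beta> assms by (intro RL_integral_bound) auto
  also have "\<dots> \<le> B * (a powr \<beta> / \<beta>)"
    using \<beta> assms \<open>B \<ge> 0\<close> by (intro mult_left_mono) (auto intro!: divide_right_mono powr_mono2)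
  finally have "\<bar>RL_integral (1 - \<beta>) v x\<bar> / Gamma \<beta> \<le> B * (a powr \<beta> / \<beta>) / Gamma \<beta>"
    using Gamma_\<beta> by (intro divide_right_mono) auto
  then show ?thesis using Gamma_\<beta> by (simp add: J_def J_norm_def mult_ac)
qed

lemma J_diff:
  assumes "continuous_on {0..x} v" "continuous_on {0..x} w" "0 \<le> x"
  shows "J (\<lambda>t. v t - w t) x = J v x - J w x"
  unfolding J_def using \<beta> assms by (subst RL_integral_diff) (auto simp: diff_divide_distrib)

lemma J_cong: "(\<And>t. t \<in> {0..x} \<Longrightarrow> v t = w t) \<Longrightarrow> J v x = J w x"
  unfolding J_def by (metis RL_integral_cong)

text \<open>Causality: only the past of \<open>v\<close> enters, which is why a delay allows a
  solution to be built interval by interval.\<close>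

lemma N_cong: "(\<And>t. t \<in> {0..x} \<Longrightarrow> v t = w t) \<Longrightarrow> 0 \<le> x \<Longrightarrow> N v x = N w x"
  unfolding N_def using J_cong[of x v w] by simp

lemma continuous_on_N:
  assumes "continuous_on {0..x} v" "x \<in> {0..a}"
  shows "continuous_on {0..x} (N v)"
  unfolding N_def using assms
  by (intro continuous_on_compose2[OF F_cont] continuous_intros continuous_on_J) auto

definition is_fixpoint :: "(real \<Rightarrow> real) \<Rightarrow> bool" where
  "is_fixpoint v \<longleftrightarrow> continuous_on {0..a} v \<and>
     (\<forall>x\<in>{0..a}. v x = b + integral {0..x} (\<lambda>t. N v t / t powr \<beta>))"

text \<open>For \<open>h > 0\<close> the value at \<open>x\<close> depends on \<open>v\<close> up to
  \<open>x - h\<close> only. A fixed point is then reached after finitely many iterations, with no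
  contraction property; on \<open>[0,h]\<close> it is the constant \<open>b\<close>.\<close>

definition delayed :: "real \<Rightarrow> (real \<Rightarrow> real) \<Rightarrow> real \<Rightarrow> real" where
  "delayed h v x = b + integral {0..max 0 (x - h)} (\<lambda>t. N v t / t powr \<beta>)"

definition iter :: "real \<Rightarrow> nat \<Rightarrow> real \<Rightarrow> real" where
  "iter h k = (delayed h ^^ k) (\<lambda>_. b)"

lemma iter_0: "iter h 0 x = b" and iter_Suc: "iter h (Suc k) = delayed h (iter h k)"
  by (simp_all add: iter_def)

lemma continuous_on_delayed:
  assumes "continuous_on {0..a} v" "0 \<le> h"
  shows "continuous_on {0..a} (delayed h v)"
proof -
  have "continuous_on {0..a} (\<lambda>x. integral {0..x} (\<lambda>t. N v t / t powr \<beta>))"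
    using \<beta> a assms by (intro indefinite_integral_continuous_1 weighted_integrable continuous_on_N) auto
  moreover have "continuous_on {0..a} (\<lambda>x. max 0 (x - h))" by (intro continuous_intros)
  ultimately have "continuous_on {0..a} (\<lambda>x. integral {0..max 0 (x - h)} (\<lambda>t. N v t / t powr \<beta>))"
    by (rule continuous_on_compose2) (use \<open>0 \<le> h\<close> in auto)
  then show ?thesis unfolding delayed_def[abs_def] by (intro continuous_intros)
qed

lemma continuous_on_iter: "0 \<le> h \<Longrightarrow> continuous_on {0..a} (iter h k)"
proof (induction k)
  case 0
  have "iter h 0 = (\<lambda>_. b)" by (simp add: iter_def)
  then show ?case by simp
qed (simp add: iter_Suc continuous_on_delayed)

text \<open>The integral up to \<open>x - h\<close> only sees values at arguments at most \<open>x - h\<close>, so each iteration fixes the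
  values on one more interval of length \<open>h\<close>.\<close>

lemma iter_stable:
  assumes "0 < h" "x \<in> {0..a}" "x \<le> real k * h"
  shows "iter h (Suc k) x = iter h k x"
  using assms(2,3)
proof (induction k arbitrary: x)
  case 0
  then show ?case using assms(1) by (simp add: iter_Suc delayed_def iter_0)
next
  case (Suc k)
  have "integral {0..max 0 (x - h)} (\<lambda>t. N (iter h (Suc k)) t / t powr \<beta>) =
      integral {0..max 0 (x - h)} (\<lambda>t. N (iter h k) t / t powr \<beta>)"
  proof (rule integral_cong)
    fix t assume t: "t \<in> {0..max 0 (x - h)}"
    have "N (iter h (Suc k)) t = N (iter h k) t"
    proof (rule N_cong)
      fix s assume s: "s \<in> {0..t}"
      have "max 0 (x - h) \<le> real k * h"
        using Suc.prems assms(1) by (intro max.boundedI) (auto simp: algebra_simps)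
      with s t have "s \<le> real k * h" unfolding atLeastAtMost_iff by linarith
      then show "iter h (Suc k) s = iter h k s"
        using s t Suc.prems assms(1) by (intro Suc.IH) auto
    qed (use t in auto)
    then show "N (iter h (Suc k)) t / t powr \<beta> = N (iter h k) t / t powr \<beta>" by simp
  qed
  then show ?case by (simp add: iter_Suc[of h "Suc k"] iter_Suc[of h k] delayed_def)
qed

end

section \<open>Uniform bounds and existence by compactness\<close>

locale fractional_volterra_linear_growth = fractional_volterra +
  fixes L :: real
  assumes L: "L > 0"
    and growth: "\<And>x w v. x \<in> {0..a} \<Longrightarrow> \<bar>F (x, w, v)\<bar> \<le> L * (1 + \<bar>w\<bar> + \<bar>v\<bar>)"
begin

text \<open>The divisor \<open>1 - \<beta>\<close> cancels the chain rule factor, so that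
  \<open>bnd\<close> has derivative \<open>L * (2 + J_norm) * bnd x / x powr \<beta>\<close> for
  \<open>x > 0\<close>.\<close>

definition rate :: real where "rate = L * (2 + J_norm) / (1 - \<beta>)"

text \<open>The summand \<open>1\<close> keeps \<open>bnd\<close> above \<open>1\<close>, so that
  the constant term of \<open>growth\<close> can be absorbed into a multiple of
  \<open>bnd\<close>.\<close>

definition bnd :: "real \<Rightarrow> real" where
  "bnd x = (\<bar>b\<bar> + 1) * exp (rate * x powr (1 - \<beta>))"

lemma rate_pos: "rate > 0"
  unfolding rate_def using L \<beta> J_norm_nonneg by (intro divide_pos_pos mult_pos_pos) auto

lemma bnd_mono: "0 \<le> x \<Longrightarrow> x \<le> y \<Longrightarrow> bnd x \<le> bnd y"
  unfolding bnd_def using rate_pos \<beta> by (intro mult_left_mono) (auto intro!: mult_left_mono powr_mono2)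

lemma bnd_ge_1: "1 \<le> bnd x"
proof -
  have "1 * 1 \<le> (\<bar>b\<bar> + 1) * exp (rate * x powr (1 - \<beta>))"
    using rate_pos by (intro mult_mono) auto
  then show ?thesis by (simp add: bnd_def)
qed

lemma N_bound:
  assumes "continuous_on {0..a} v" "x \<in> {0..a}" "\<And>t. t \<in> {0..x} \<Longrightarrow> \<bar>v t\<bar> \<le> B" "1 \<le> B"
  shows "\<bar>N v x\<bar> \<le> L * ((2 + J_norm) * B)"
proof -
  have "\<bar>N v x\<bar> \<le> L * (1 + \<bar>J v x\<bar> + \<bar>v x\<bar>)" unfolding N_def by (rule growth[OF assms(2)])
  also have "\<dots> \<le> L * ((2 + J_norm) * B)"
  proof (rule mult_left_mono)
    have "\<bar>J v x\<bar> \<le> J_norm * B"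
      using assms by (intro J_bound continuous_on_subset[OF assms(1)]) auto
    moreover have "\<bar>v x\<bar> \<le> B" using assms by auto
    ultimately show "1 + \<bar>J v x\<bar> + \<bar>v x\<bar> \<le> (2 + J_norm) * B" using assms(4) by (simp add: algebra_simps)
  qed (use L in simp)
  finally show ?thesis .
qed

text \<open>Induction on \<open>k\<close> with \<open>bnd\<close> as a supersolution, uniformly in
  \<open>h\<close> and \<open>k\<close>. Since \<open>bnd\<close> is nondecreasing, it controls the
  whole past entering \<open>N\<close> and also the shortened upper limit.\<close>

lemma iter_bound:
  assumes "0 \<le> h" "x \<in> {0..a}"
  shows "\<bar>iter h k x\<bar> \<le> bnd x"
  using assms(2)
proof (induction k arbitrary: x)
  case 0
  have "\<bar>b\<bar> * 1 \<le> (\<bar>b\<bar> + 1) * exp (rate * x powr (1 - \<beta>))"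
    using rate_pos by (intro mult_mono) auto
  then show ?case by (simp add: iter_0 bnd_def)
next
  case (Suc k)
  define y where "y = max 0 (x - h)"
  have y: "0 \<le> y" "y \<le> x" "y \<le> a" using Suc.prems assms(1) by (auto simp: y_def)
  have exp_int: "((\<lambda>t. (\<bar>b\<bar> + 1) * (rate * (1 - \<beta>) * exp (rate * t powr (1 - \<beta>)) / t powr \<beta>)) has_integral
      (\<bar>b\<bar> + 1) * (exp (rate * y powr (1 - \<beta>)) - 1)) {0..y}"
    using \<beta> y by (intro has_integral_mult_right weighted_integral_exp) auto
  have "norm (integral {0..y} (\<lambda>t. N (iter h k) t / t powr \<beta>)) \<le>
      integral {0..y} (\<lambda>t. (\<bar>b\<bar> + 1) * (rate * (1 - \<beta>) * exp (rate * t powr (1 - \<beta>)) / t powr \<beta>))"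
  proof (rule integral_norm_bound_integral)
    show "(\<lambda>t. N (iter h k) t / t powr \<beta>) integrable_on {0..y}"
      using y \<beta> assms(1)
      by (intro weighted_integrable continuous_on_N continuous_on_subset[OF continuous_on_iter]) auto
    fix t assume t: "t \<in> {0..y}"
    have "\<bar>N (iter h k) t\<bar> \<le> L * ((2 + J_norm) * bnd t)"
    proof (rule N_bound[OF continuous_on_iter[OF assms(1)]])
      fix s assume "s \<in> {0..t}"
      then show "\<bar>iter h k s\<bar> \<le> bnd t"
        using Suc.IH[of s] bnd_mono[of s t] t y Suc.prems by auto
    qed (use t y Suc.prems bnd_ge_1 in auto)
    also have "\<dots> = (\<bar>b\<bar> + 1) * (rate * (1 - \<beta>) * exp (rate * t powr (1 - \<beta>)))"
      using \<beta> by (simp add: rate_def bnd_def)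
    finally show "norm (N (iter h k) t / t powr \<beta>) \<le>
        (\<bar>b\<bar> + 1) * (rate * (1 - \<beta>) * exp (rate * t powr (1 - \<beta>)) / t powr \<beta>)"
      using divide_right_mono[of _ _ "t powr \<beta>"] by fastforce
  qed (use exp_int in blast)
  also have "\<dots> = (\<bar>b\<bar> + 1) * (exp (rate * y powr (1 - \<beta>)) - 1)"
    using exp_int by (rule integral_unique)
  also have "\<dots> = bnd y - (\<bar>b\<bar> + 1)" by (simp add: bnd_def algebra_simps)
  also have "\<dots> \<le> bnd x - \<bar>b\<bar>" using bnd_mono[OF y(1,2)] by simp
  finally show ?case by (simp add: iter_Suc delayed_def flip: y_def)
qed

lemma iter_N_bound:
  assumes "0 \<le> h" "t \<in> {0..a}"
  shows "\<bar>N (iter h k) t\<bar> \<le> L * ((2 + J_norm) * bnd a)"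
proof (rule N_bound[OF continuous_on_iter[OF assms(1)] assms(2)])
  show "\<bar>iter h k s\<bar> \<le> bnd a" if "s \<in> {0..t}" for s
    using that assms iter_bound[of h s k] bnd_mono[of s a] by force
qed (rule bnd_ge_1)

text \<open>The exact solutions \<open>u n\<close> with delay \<open>h n\<close> are bounded and
  equicontinuous, so a subsequence converges uniformly. Dominated convergence passes to the limit in
  the integral over \<open>[0,x]\<close>, and the error from the delay tends to
  \<open>0\<close>.\<close>

theorem ex_fixpoint: "\<exists>v. is_fixpoint v"
proof -
  define h where "h n = a / real (Suc n)" for n
  \<comment> \<open>As \<open>Suc n * h n = a\<close>, this many iterations are stable on all of
    \<open>[0,a]\<close>, so \<open>u n\<close> solves the delayed equation exactly there; see
    \<open>u_eq\<close>.\<close>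
  define u where "u n = iter (h n) (Suc n)" for n
  define M where "M = L * ((2 + J_norm) * bnd a)"
  define \<omega> where "\<omega> x = x powr (1 - \<beta>) / (1 - \<beta>)" for x
  have h: "h n > 0" for n using a by (simp add: h_def)
  have M: "M > 0" unfolding M_def using L J_norm_nonneg bnd_ge_1[of a] by (intro mult_pos_pos) auto
  have u_cont: "continuous_on {0..a} (u n)" for n
    unfolding u_def using h[of n] by (intro continuous_on_iter) simp
  have u_eq: "u n x = delayed (h n) (u n) x" if "x \<in> {0..a}" for n x
    using iter_stable[OF h[of n] that, of "Suc n"] that a by (simp add: u_def iter_Suc h_def)
  have N_M: "\<bar>N (u n) t\<bar> \<le> M" if "t \<in> {0..a}" for n t
    unfolding u_def M_def using h[of n] that by (intro iter_N_bound) auto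
  have N_cont: "continuous_on {0..a} (N v)" if "continuous_on {0..a} v" for v
    using that a by (intro continuous_on_N) auto
  have clip: "max 0 (x - h n) \<in> {0..a}" if "x \<in> {0..a}" for x n using that h[of n] by auto
  have \<omega>_cont: "continuous_on {0..a} \<omega>"
    unfolding \<omega>_def using \<beta> by (intro continuous_intros continuous_on_powr') auto
  have u_diff: "\<bar>u n x - u n y\<bar> \<le> M * \<bar>\<omega> (max 0 (x - h n)) - \<omega> (max 0 (y - h n))\<bar>"
    if "x \<in> {0..a}" "y \<in> {0..a}" for n x y
    using weighted_integral_diff_bound[OF \<beta>(2) N_cont[OF u_cont] N_M clip[OF that(1)] clip[OF that(2)], of n n]
    by (simp add: u_eq[OF that(1)] u_eq[OF that(2)] delayed_def \<omega>_def)
  have uc: "uniformly_continuous_on {0..a} \<omega>"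
    using \<omega>_cont by (rule compact_uniformly_continuous) simp
  obtain v r where v: "continuous_on {0..a} v" "strict_mono (r :: nat \<Rightarrow> nat)"
    and lim: "\<And>e. 0 < e \<Longrightarrow> \<exists>K. \<forall>n x. n \<ge> K \<and> x \<in> {0..a} \<longrightarrow> norm (u (r n) x - v x) < e"
  proof (rule Arzela_Ascoli[of "{0..a}" u "bnd a"])
    show "norm (u n x) \<le> bnd a" if "x \<in> {0..a}" for n x
      using that iter_bound[of "h n" x "Suc n"] bnd_mono[of x a] h[of n] by (auto simp: u_def)
    fix x e :: real assume x: "x \<in> {0..a}" and "0 < e"
    then have eM: "e / M > 0" using M by simp
    obtain d where d: "d > 0"
      "\<And>y z. y \<in> {0..a} \<Longrightarrow> z \<in> {0..a} \<Longrightarrow> dist z y < d \<Longrightarrow> dist (\<omega> z) (\<omega> y) < e / M"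
      by (rule uniformly_continuous_onE[OF uc eM]) blast
    have "norm (u n x - u n y) < e" if y: "y \<in> {0..a}" "norm (x - y) < d" for n y
    proof -
      \<comment> \<open>Shifting and clipping do not increase distances, so \<open>d\<close> works
        for every \<open>n\<close>.\<close>
      have "dist (max 0 (x - h n)) (max 0 (y - h n)) < d" using y by (auto simp: dist_real_def)
      then have "\<bar>\<omega> (max 0 (x - h n)) - \<omega> (max 0 (y - h n))\<bar> < e / M"
        using d(2)[OF clip clip] x y by (simp add: dist_real_def)
      then have "M * \<bar>\<omega> (max 0 (x - h n)) - \<omega> (max 0 (y - h n))\<bar> < e"
        using M by (simp add: field_simps)
      then show ?thesis using u_diff[OF x y(1), of n] by simp
    qed
    then show "\<exists>d>0. \<forall>n y. y \<in> {0..a} \<and> norm (x - y) < d \<longrightarrow> norm (u n x - u n y) < e"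
      using d(1) by blast
  qed auto
  have u_lim: "(\<lambda>n. u (r n) t) \<longlonglongrightarrow> v t" if "t \<in> {0..a}" for t
    unfolding LIMSEQ_iff using lim that by meson
  \<comment> \<open>Uniform convergence on \<open>[0,t]\<close> enters here, through
    \<open>J_bound\<close> applied to the difference.\<close>
  have J_lim: "(\<lambda>n. J (u (r n)) t) \<longlonglongrightarrow> J v t" if t: "t \<in> {0..a}" for t
    unfolding LIMSEQ_iff
  proof (intro allI impI)
    fix e :: real assume "e > 0"
    then have "e / (J_norm + 1) > 0" using J_norm_nonneg by simp
    then obtain K where K: "\<And>n x. n \<ge> K \<Longrightarrow> x \<in> {0..a} \<Longrightarrow> norm (u (r n) x - v x) < e / (J_norm + 1)"
      using lim by meson
    have "norm (J (u (r n)) t - J v t) < e" if "n \<ge> K" for n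
    proof -
      have sub: "continuous_on {0..t} (u (r n))" "continuous_on {0..t} v"
        using t by (auto intro: continuous_on_subset[OF u_cont] continuous_on_subset[OF v(1)])
      have "\<bar>J (\<lambda>s. u (r n) s - v s) t\<bar> \<le> J_norm * (e / (J_norm + 1))"
        using K[OF that] t by (intro J_bound continuous_on_diff sub) (auto intro: less_imp_le)
      also have "\<dots> < e" using \<open>e > 0\<close> J_norm_nonneg by (simp add: field_simps)
      finally show ?thesis using J_diff[OF sub] t by simp
    qed
    then show "\<exists>K. \<forall>n\<ge>K. norm (J (u (r n)) t - J v t) < e" by blast
  qed
  have N_lim: "(\<lambda>n. N (u (r n)) t) \<longlonglongrightarrow> N v t" if t: "t \<in> {0..a}" for t
    unfolding N_def using t
    by (intro continuous_on_tendsto_compose[OF F_cont] tendsto_Pair tendsto_const J_lim u_lim) auto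
  have "v x = b + integral {0..x} (\<lambda>t. N v t / t powr \<beta>)" if x: "x \<in> {0..a}" for x
  proof -
    define P where "P n y = integral {0..y} (\<lambda>t. N (u (r n)) t / t powr \<beta>)" for n y
    have "(\<lambda>n. P n x) \<longlonglongrightarrow> integral {0..x} (\<lambda>t. N v t / t powr \<beta>)"
      unfolding P_def
    proof (rule dominated_convergence(2))
      show "(\<lambda>t. N (u (r n)) t / t powr \<beta>) integrable_on {0..x}" for n
        using x \<beta> by (intro weighted_integrable continuous_on_subset[OF N_cont[OF u_cont]]) auto
      show "(\<lambda>t. M * (1 / t powr \<beta>)) integrable_on {0..x}"
        using x \<beta> has_integral_weight[of \<beta> x] by (intro integrable_on_mult_right) auto
      fix t assume t: "t \<in> {0..x}"
      show "norm (N (u (r n)) t / t powr \<beta>) \<le> M * (1 / t powr \<beta>)" for n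
        using N_M[of t "r n"] t x by (simp add: divide_right_mono)
      show "(\<lambda>n. N (u (r n)) t / t powr \<beta>) \<longlonglongrightarrow> N v t / t powr \<beta>"
        unfolding divide_inverse using N_lim[of t] t x by (intro tendsto_mult_right) auto
    qed
    \<comment> \<open>The part of the integral cut off by the delay is at most \<open>M\<close>
      times an increment of \<open>\<omega>\<close> over a shrinking interval.\<close>
    moreover have "(\<lambda>n. P n (max 0 (x - h (r n))) - P n x) \<longlonglongrightarrow> 0"
    proof (rule Lim_null_comparison)
      show "\<forall>\<^sub>F n in sequentially. norm (P n (max 0 (x - h (r n))) - P n x) \<le>
          M * \<bar>\<omega> (max 0 (x - h (r n))) - \<omega> x\<bar>"
        using weighted_integral_diff_bound[OF \<beta>(2) N_cont[OF u_cont] N_M clip[OF x] x]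
        by (intro always_eventually) (simp add: P_def \<omega>_def)
      have "h \<longlonglongrightarrow> 0" unfolding h_def[abs_def] using LIMSEQ_Suc[OF lim_const_over_n[of a]] by simp
      then have "(\<lambda>n. h (r n)) \<longlonglongrightarrow> 0" using LIMSEQ_subseq_LIMSEQ[OF _ v(2)] by (auto simp: o_def)
      then have "(\<lambda>n. max 0 (x - h (r n))) \<longlonglongrightarrow> max 0 (x - 0)" by (intro tendsto_intros)
      also have "max 0 (x - 0) = x" using x by simp
      finally have "(\<lambda>n. \<omega> (max 0 (x - h (r n)))) \<longlonglongrightarrow> \<omega> x"
        using clip[OF x] x by (intro continuous_on_tendsto_compose[OF \<omega>_cont]) auto
      then have "(\<lambda>n. M * \<bar>\<omega> (max 0 (x - h (r n))) - \<omega> x\<bar>) \<longlonglongrightarrow> M * \<bar>\<omega> x - \<omega> x\<bar>"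
        by (intro tendsto_intros)
      then show "(\<lambda>n. M * \<bar>\<omega> (max 0 (x - h (r n))) - \<omega> x\<bar>) \<longlonglongrightarrow> 0" by simp
    qed
    ultimately have "(\<lambda>n. b + (P n x + (P n (max 0 (x - h (r n))) - P n x))) \<longlonglongrightarrow>
        b + (integral {0..x} (\<lambda>t. N v t / t powr \<beta>) + 0)"
      by (intro tendsto_add tendsto_const)
    then have "(\<lambda>n. u (r n) x) \<longlonglongrightarrow> b + integral {0..x} (\<lambda>t. N v t / t powr \<beta>)"
      by (simp add: u_eq[OF x] delayed_def P_def)
    with u_lim[OF x] show ?thesis by (rule LIMSEQ_unique)
  qed
  with v(1) show ?thesis unfolding is_fixpoint_def by blast
qed

end

section \<open>Uniqueness for the integral equation\<close>

context fractional_volterra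
begin

text \<open>\<open>F_diff\<close> bounds \<open>v - w\<close> by a weighted integral of
  \<open>g (\<Phi> t) powr (1 / p)\<close>. The power mean inequality removes the root, the bound on
  \<open>J\<close> handles the other term of \<open>\<Phi>\<close>, and the resulting inequality for
  \<open>\<Phi>\<close> is of Osgood type.\<close>

theorem fixpoint_unique:
  fixes g :: "real \<Rightarrow> real" and p C :: real
  assumes g: "continuous_on {0..} g" "\<And>u. u \<ge> 0 \<Longrightarrow> g u \<ge> 0" "mono_on {0..} g" "osgood g"
    and "p > 1" "C \<ge> 0"
    and F_diff: "\<And>x w1 v1 w2 v2. x \<in> {0..a} \<Longrightarrow>
        \<bar>F (x, w1, v1) - F (x, w2, v2)\<bar> \<le> C * g (\<bar>w1 - w2\<bar> powr p + \<bar>v1 - v2\<bar> powr p) powr (1 / p)"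
    and v: "is_fixpoint v" and w: "is_fixpoint w" and "x \<in> {0..a}"
  shows "v x = w x"
proof -
  define \<Phi> where "\<Phi> t = \<bar>J v t - J w t\<bar> powr p + \<bar>v t - w t\<bar> powr p" for t
  define W where "W x = integral {0..x} (\<lambda>t. g (\<Phi> t) / t powr \<beta>)" for x
  define \<omega> where "\<omega> x = x powr (1 - \<beta>) / (1 - \<beta>)" for x
  \<comment> \<open>\<open>C\<close> comes from \<open>F_diff\<close>, and the power of
    \<open>\<omega> a\<close>, the mass of the weight on \<open>[0,a]\<close>, from the power mean
    inequality.\<close>
  define D where "D = C powr p * \<omega> a powr (p - 1)"
  have cont: "continuous_on {0..a} v" "continuous_on {0..a} w"
    using v w by (auto simp: is_fixpoint_def)
  have \<Phi>0: "\<Phi> t \<ge> 0" for t by (simp add: \<Phi>_def)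
  have \<Phi>_cont: "continuous_on {0..a} \<Phi>"
    unfolding \<Phi>_def using \<open>p > 1\<close> cont a
    by (intro continuous_intros continuous_on_powr' continuous_on_J) auto
  have g\<Phi>: "continuous_on {0..a} (\<lambda>t. g (\<Phi> t))"
    using \<Phi>0 by (intro continuous_on_compose2[OF g(1) \<Phi>_cont]) auto
  have gp: "continuous_on {0..a} (\<lambda>t. g (\<Phi> t) powr (1 / p))"
    using \<open>p > 1\<close> g(2)[OF \<Phi>0] by (intro continuous_on_powr' g\<Phi> continuous_intros) auto
  have N_cont: "continuous_on {0..a} (N v)" "continuous_on {0..a} (N w)"
    using cont a by (auto intro: continuous_on_N)
  have int: "(\<lambda>t. \<phi> t / t powr \<beta>) integrable_on {0..x}" if "continuous_on {0..a} \<phi>" "x \<in> {0..a}" for \<phi> x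
    using that \<beta> by (intro weighted_integrable continuous_on_subset[OF that(1)]) auto
  have W_mono: "W x \<le> W y" if "0 \<le> x" "x \<le> y" "y \<le> a" for x y
    unfolding W_def using that g(2)[OF \<Phi>0] by (intro integral_subset_le int g\<Phi>) auto
  have W0: "W x \<ge> 0" if "x \<in> {0..a}" for x
    using W_mono[of 0 x] that by (simp add: W_def)
  have D0: "D \<ge> 0" by (simp add: D_def)
  have v_diff: "\<bar>v x - w x\<bar> powr p \<le> D * W x" if x: "x \<in> {0..a}" for x
  proof (cases "x = 0")
    case True
    then show ?thesis using v w x a W0[OF x] D0 by (simp add: is_fixpoint_def)
  next
    case False
    with x have "x > 0" by simp
    define Y where "Y = integral {0..x} (\<lambda>t. g (\<Phi> t) powr (1 / p) * (1 / t powr \<beta>))"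
    have \<omega>: "0 < \<omega> x" "\<omega> x \<le> \<omega> a" using \<open>x > 0\<close> x \<beta>
      by (auto simp: \<omega>_def intro!: divide_right_mono powr_mono2)
    have Y0: "Y \<ge> 0" unfolding Y_def using int[OF gp x] by (intro integral_nonneg) auto
    have "v x - w x = integral {0..x} (\<lambda>t. N v t / t powr \<beta>) - integral {0..x} (\<lambda>t. N w t / t powr \<beta>)"
      using v w x by (simp add: is_fixpoint_def)
    also have "\<dots> = integral {0..x} (\<lambda>t. N v t / t powr \<beta> - N w t / t powr \<beta>)"
      using int[OF N_cont(1) x] int[OF N_cont(2) x] by (rule integral_diff[symmetric])
    finally have "\<bar>v x - w x\<bar> = norm (integral {0..x} (\<lambda>t. N v t / t powr \<beta> - N w t / t powr \<beta>))" by simp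
    also have "\<dots> \<le> integral {0..x} (\<lambda>t. C * (g (\<Phi> t) powr (1 / p) * (1 / t powr \<beta>)))"
    proof (rule integral_norm_bound_integral)
      show "(\<lambda>t. C * (g (\<Phi> t) powr (1 / p) * (1 / t powr \<beta>))) integrable_on {0..x}"
        using int[OF gp x] by (intro integrable_on_mult_right) simp
      fix t assume "t \<in> {0..x}"
      then have "\<bar>N v t - N w t\<bar> \<le> C * g (\<Phi> t) powr (1 / p)"
        unfolding N_def \<Phi>_def using x by (intro F_diff) auto
      from divide_right_mono[OF this, of "t powr \<beta>"]
      show "norm (N v t / t powr \<beta> - N w t / t powr \<beta>) \<le> C * (g (\<Phi> t) powr (1 / p) * (1 / t powr \<beta>))"
        by (simp flip: diff_divide_distrib)
    qed (intro integrable_diff int N_cont x)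
    also have "\<dots> = C * Y" unfolding Y_def by (rule integral_mult_right)
    finally have "\<bar>v x - w x\<bar> powr p \<le> (C * Y) powr p" using \<open>p > 1\<close> by (intro powr_mono2) auto
    also have "\<dots> = C powr p * Y powr p" using \<open>C \<ge> 0\<close> Y0 by (simp add: powr_mult)
    also have "\<dots> \<le> C powr p * (\<omega> a powr (p - 1) * W x)"
    proof (rule mult_left_mono)
      \<comment> \<open>Dividing by the mass \<open>\<omega> x\<close>, positive because
        \<open>x > 0\<close>, yields
        \<open>Y powr p \<le> W x * \<omega> x powr (p - 1)\<close>.\<close>
      have "\<omega> x * (Y / \<omega> x) powr p \<le> integral {0..x} (\<lambda>t. (g (\<Phi> t) powr (1 / p)) powr p * (1 / t powr \<beta>))"
        unfolding Y_def
      proof (rule weighted_power_mean[OF \<open>p > 1\<close> _ _ _ _ \<omega>(1)])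
        show "continuous_on {0..x} (\<lambda>t. g (\<Phi> t) powr (1 / p))"
          using x by (intro continuous_on_subset[OF gp]) auto
        show "((\<lambda>t. 1 / t powr \<beta>) has_integral \<omega> x) {0..x}"
          unfolding \<omega>_def using x \<beta> by (intro has_integral_weight) auto
      qed auto
      also have "\<dots> = W x"
        unfolding W_def using \<open>p > 1\<close> g(2)[OF \<Phi>0] by (intro integral_cong) (auto simp: powr_powr)
      also have "\<omega> x * (Y / \<omega> x) powr p = Y powr p / \<omega> x powr (p - 1)"
        using \<omega>(1) Y0 by (simp add: powr_divide powr_diff)
      finally have "Y powr p \<le> W x * \<omega> x powr (p - 1)" using \<omega>(1) by (simp add: pos_divide_le_eq)
      also have "\<dots> \<le> W x * \<omega> a powr (p - 1)"
        using \<omega> \<open>p > 1\<close> W0[OF x] by (intro mult_left_mono powr_mono2) auto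
      finally show "Y powr p \<le> \<omega> a powr (p - 1) * W x" by (simp add: mult.commute)
    qed simp
    finally show ?thesis by (simp add: D_def)
  qed
  have "\<Phi> x = 0"
  proof (rule osgood_integral_inequality[OF g \<beta>(2) _ \<Phi>_cont \<Phi>0])
    show "(1 + J_norm powr p) * D \<ge> 0" using D0 by (intro mult_nonneg_nonneg) auto
    fix x assume x: "x \<in> {0..a}"
    \<comment> \<open>Since \<open>W\<close> is nondecreasing, \<open>\<delta>\<close> bounds
      \<open>v - w\<close> on all of \<open>[0,x]\<close>, as \<open>J_bound\<close>
      requires.\<close>
    define \<delta> where "\<delta> = (D * W x) powr (1 / p)"
    have DW: "D * W x \<ge> 0" using D0 W0[OF x] by simp
    then have \<delta>p: "\<delta> powr p = D * W x" using \<open>p > 1\<close> by (simp add: \<delta>_def powr_powr)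
    have sub: "continuous_on {0..x} v" "continuous_on {0..x} w"
      using x by (auto intro: continuous_on_subset[OF cont(1)] continuous_on_subset[OF cont(2)])
    have "\<bar>v t - w t\<bar> \<le> \<delta>" if t: "t \<in> {0..x}" for t
    proof -
      have "\<bar>v t - w t\<bar> powr p \<le> D * W t" using t x by (intro v_diff) auto
      also have "\<dots> \<le> D * W x" using t x by (intro mult_left_mono W_mono D0) auto
      finally have "(\<bar>v t - w t\<bar> powr p) powr (1 / p) \<le> \<delta>"
        unfolding \<delta>_def using \<open>p > 1\<close> by (intro powr_mono2) auto
      then show ?thesis using \<open>p > 1\<close> by (simp add: powr_powr)
    qed
    then have "\<bar>J (\<lambda>t. v t - w t) x\<bar> \<le> J_norm * \<delta>"
      using x by (intro J_bound continuous_on_diff sub)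
    then have "\<bar>J v x - J w x\<bar> \<le> J_norm * \<delta>" using J_diff[OF sub] x by simp
    then have "\<bar>J v x - J w x\<bar> powr p \<le> (J_norm * \<delta>) powr p" using \<open>p > 1\<close> by (intro powr_mono2) auto
    also have "\<dots> = J_norm powr p * (D * W x)" using J_norm_nonneg \<delta>p by (simp add: powr_mult)
    finally have "\<Phi> x \<le> (1 + J_norm powr p) * D * W x"
      using v_diff[OF x] by (simp add: \<Phi>_def algebra_simps)
    then show "\<Phi> x \<le> (1 + J_norm powr p) * D * integral {0..x} (\<lambda>t. g (\<Phi> t) / t powr \<beta>)"
      by (simp only: W_def)
  qed (use \<open>x \<in> {0..a}\<close> in auto)
  moreover have "\<bar>J v x - J w x\<bar> powr p \<ge> 0" "\<bar>v x - w x\<bar> powr p \<ge> 0" by auto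
  ultimately have "\<bar>v x - w x\<bar> powr p = 0" unfolding \<Phi>_def by linarith
  then show ?thesis by simp
qed

end

section \<open>Fractional derivatives of solutions\<close>

lemma has_vector_derivative_cong_within:
  assumes "(f has_vector_derivative D) (at x within S)" "x \<in> S" "\<And>y. y \<in> S \<Longrightarrow> g y = f y"
  shows "(g has_vector_derivative D) (at x within S)"
  using assms has_vector_derivative_transform[of x S g f D] by auto

context fractional_volterra
begin

lemma vector_derivative_within:
  "(f has_vector_derivative D) (at x within {0..a}) \<Longrightarrow> x \<in> {0..a} \<Longrightarrow>
    vector_derivative f (at x within {0..a}) = D"
  for f :: "real \<Rightarrow> real"
  using vector_derivative_within_closed_interval[of 0 a x f D] a by auto

text \<open>Abel's identity with exponent \<open>1 - \<beta>\<close>; the normalisation of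
  \<open>J\<close> cancels \<open>Gamma \<beta>\<close>. Differentiation then makes \<open>J\<close>
  a right inverse of \<open>RL_deriv\<close>.\<close>

lemma RL_integral_J:
  assumes "continuous_on {0..a} v" "x \<in> {0..a}"
  shows "RL_integral \<beta> (J v) x = Gamma (1 - \<beta>) * integral {0..x} v"
proof -
  have "RL_integral \<beta> (J v) x = RL_integral \<beta> (\<lambda>t. (1 / Gamma \<beta>) * RL_integral (1 - \<beta>) v t) x"
    by (intro RL_integral_cong) (simp add: J_def)
  also have "\<dots> = 1 / Gamma \<beta> * RL_integral (1 - (1 - \<beta>)) (RL_integral (1 - \<beta>) v) x"
    by (simp only: RL_integral_cmult) simp
  also have "\<dots> = 1 / Gamma \<beta> * (Gamma (1 - \<beta>) * Gamma (1 - (1 - \<beta>)) * integral {0..x} v)"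
    using assms \<beta> by (subst Abel_identity) (auto intro: continuous_on_subset[OF assms(1)])
  finally show ?thesis using Gamma_\<beta> by simp
qed

lemma RL_integral_J_has_derivative:
  assumes "continuous_on {0..a} v" "x \<in> {0..a}"
  shows "(RL_integral \<beta> (J v) has_vector_derivative Gamma (1 - \<beta>) * v x) (at x within {0..a})"
proof (rule has_vector_derivative_cong_within)
  show "((\<lambda>x. Gamma (1 - \<beta>) * integral {0..x} v) has_vector_derivative Gamma (1 - \<beta>) * v x)
      (at x within {0..a})"
    by (intro has_vector_derivative_mult_right integral_has_vector_derivative assms)
qed (use assms RL_integral_J in auto)

lemma RL_deriv_J:
  assumes "continuous_on {0..a} v" "x \<in> {0..a}"
  shows "RL_deriv \<beta> a (J v) x = v x"
  using vector_derivative_within[OF RL_integral_J_has_derivative[OF assms] assms(2)] \<beta>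
  by (simp add: RL_deriv_def Gamma_real_nonzero)

lemma J_in_RL_space:
  assumes "continuous_on {0..a} v"
  shows "J v \<in> RL_space \<beta> a"
proof -
  have "continuous_on {0..a} (RL_deriv \<beta> a (J v)) \<longleftrightarrow> continuous_on {0..a} v"
    by (intro continuous_on_cong refl RL_deriv_J assms)
  then show ?thesis
    unfolding RL_space_def using assms a
    by (auto intro: continuous_on_J differentiableI_vector[OF RL_integral_J_has_derivative[OF assms]])
qed

text \<open>Both sides have the same fractional integral, because the two integrals share their
  derivative and vanish at \<open>0\<close>; injectivity concludes. No multiple of
  \<open>x powr (\<beta> - 1)\<close> appears, since \<open>RL_integral \<beta> \<omega>\<close> is
  differentiable up to \<open>0\<close>.\<close>

lemma RL_space_eq_J:
  assumes "\<omega> \<in> RL_space \<beta> a" "x \<in> {0..a}"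
  shows "\<omega> x = J (RL_deriv \<beta> a \<omega>) x"
proof (rule RL_integral_inject[OF \<beta> a _ _ _ assms(2)])
  define v where "v = RL_deriv \<beta> a \<omega>"
  have v: "continuous_on {0..a} v" using assms(1) by (simp add: RL_space_def v_def)
  show "continuous_on {0..a} \<omega>" using assms(1) by (simp add: RL_space_def)
  show "continuous_on {0..a} (J (RL_deriv \<beta> a \<omega>))"
    unfolding v_def[symmetric] using v a by (intro continuous_on_J) auto
  fix y assume y: "y \<in> {0..a}"
  have deriv: "(RL_integral \<beta> \<omega> has_vector_derivative Gamma (1 - \<beta>) * v t) (at t within {0..a})"
    if "t \<in> {0..a}" for t
  proof -
    have "(RL_integral \<beta> \<omega> has_vector_derivative vector_derivative (RL_integral \<beta> \<omega>) (at t within {0..a}))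
        (at t within {0..a})"
      using assms(1) that by (simp add: RL_space_def flip: vector_derivative_works)
    then show ?thesis using \<beta> by (simp add: v_def RL_deriv_def Gamma_real_nonzero)
  qed
  have ftc: "((\<lambda>t. Gamma (1 - \<beta>) * v t) has_integral RL_integral \<beta> \<omega> y - RL_integral \<beta> \<omega> 0) {0..y}"
    using y by (intro fundamental_theorem_of_calculus)
      (auto intro: has_vector_derivative_within_subset[OF deriv])
  have "RL_integral \<beta> \<omega> 0 = 0" by (simp add: RL_integral_def)
  with integral_unique[OF ftc] have "RL_integral \<beta> \<omega> y = integral {0..y} (\<lambda>t. Gamma (1 - \<beta>) * v t)"
    by linarith
  also have "\<dots> = RL_integral \<beta> (J v) y" using RL_integral_J[OF v y] by simp
  finally show "RL_integral \<beta> \<omega> y = RL_integral \<beta> (J (RL_deriv \<beta> a \<omega>)) y" by (simp add: v_def)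
qed

section \<open>Equivalence of the initial value problem and the integral equation\<close>

text \<open>The fractional derivative of \<open>J v\<close> is \<open>v\<close>, and differentiating
  the integral equation at \<open>x > 0\<close> cancels the weight against the factor
  \<open>x powr \<beta>\<close> in \<open>F\<close>.\<close>

lemma fixpoint_imp_solution:
  assumes "\<beta> = \<sigma> - 1"
    and f: "\<And>x w v. x \<in> {0<..a} \<Longrightarrow> F (x, w, v) = x powr \<beta> * f (x, w, v)"
    and v: "is_fixpoint v"
  shows "is_solution \<sigma> b a f (J v)"
proof -
  have v_cont: "continuous_on {0..a} v" using v by (simp add: is_fixpoint_def)
  define D where "D y = vector_derivative (RL_integral \<beta> (J v)) (at y within {0..a})" for y
  have D_eq: "D y = Gamma (1 - \<beta>) * v y" if "y \<in> {0..a}" for y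
    unfolding D_def using vector_derivative_within RL_integral_J_has_derivative[OF v_cont that] that by blast
  have D': "(D has_vector_derivative Gamma (1 - \<beta>) * f (x, J v x, v x)) (at x within {0..a})"
    if x: "x \<in> {0<..a}" for x
  proof (rule has_vector_derivative_cong_within)
    have "continuous_on {0..a} (N v)" using a by (intro continuous_on_N v_cont) auto
    from weighted_integral_has_derivative[OF \<beta>(2) this x]
    have "((\<lambda>x. integral {0..x} (\<lambda>t. N v t / t powr \<beta>)) has_vector_derivative f (x, J v x, v x))
        (at x within {0..a})"
      using f[OF x] x by (simp add: N_def has_real_derivative_iff_has_vector_derivative)
    then have "((\<lambda>x. b + integral {0..x} (\<lambda>t. N v t / t powr \<beta>)) has_vector_derivative 0 + f (x, J v x, v x))
        (at x within {0..a})"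
      by (intro has_vector_derivative_add has_vector_derivative_const)
    then show "((\<lambda>x. Gamma (1 - \<beta>) * (b + integral {0..x} (\<lambda>t. N v t / t powr \<beta>))) has_vector_derivative
        Gamma (1 - \<beta>) * f (x, J v x, v x)) (at x within {0..a})"
      by (intro has_vector_derivative_mult_right) simp
    show "D y = Gamma (1 - \<beta>) * (b + integral {0..y} (\<lambda>t. N v t / t powr \<beta>))" if "y \<in> {0..a}" for y
      using D_eq[OF that] v that by (simp add: is_fixpoint_def)
  qed (use x in auto)
  have "RL_integral \<beta> (J v) differentiable (at y within {0..a})" if "y \<in> {0<..a}" for y
    using RL_integral_J_has_derivative[OF v_cont, of y] that by (auto intro: differentiableI_vector)
  moreover have "D differentiable (at x within {0..a})" if "x \<in> {0<..a}" for x
    using D'[OF that] by (rule differentiableI_vector)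
  ultimately have "RL_twice_differentiable \<sigma> a (J v) x" if "x \<in> {0<..a}" for x
    unfolding RL_twice_differentiable_def using that by (simp add: D_def[abs_def] flip: assms(1))
  moreover have "RL_deriv2 \<sigma> a (J v) x = f (x, J v x, RL_deriv (\<sigma> - 1) a (J v) x)" if x: "x \<in> {0<..a}" for x
  proof -
    have "vector_derivative D (at x within {0..a}) = Gamma (1 - \<beta>) * f (x, J v x, v x)"
      using vector_derivative_within[OF D'[OF x]] x by auto
    moreover have "Gamma (2 - \<sigma>) = Gamma (1 - \<beta>)" by (simp add: assms(1))
    ultimately show ?thesis
      using RL_deriv_J[OF v_cont, of x] x \<beta>
      by (simp add: RL_deriv2_def D_def[abs_def] Gamma_real_nonzero flip: assms(1))
  qed
  moreover have "J v 0 = 0" by (simp add: J_def RL_integral_def)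
  moreover have "RL_deriv (\<sigma> - 1) a (J v) 0 = b"
    using RL_deriv_J[OF v_cont, of 0] v a by (simp add: is_fixpoint_def flip: assms(1))
  ultimately show ?thesis unfolding is_solution_def by blast
qed

text \<open>\<open>RL_space_eq_J\<close> replaces \<open>\<omega>\<close> by \<open>J v\<close>, so
  that \<open>v\<close> has derivative \<open>N v x / x powr \<beta>\<close> away from
  \<open>0\<close>; integration with \<open>v 0 = b\<close> gives the equation.\<close>

lemma solution_imp_fixpoint:
  assumes "\<beta> = \<sigma> - 1"
    and f: "\<And>x w v. x \<in> {0<..a} \<Longrightarrow> F (x, w, v) = x powr \<beta> * f (x, w, v)"
    and \<omega>: "\<omega> \<in> RL_space \<beta> a" "is_solution \<sigma> b a f \<omega>"
  shows "is_fixpoint (RL_deriv \<beta> a \<omega>)"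
proof -
  define v where "v = RL_deriv \<beta> a \<omega>"
  define D where "D y = vector_derivative (RL_integral \<beta> \<omega>) (at y within {0..a})" for y
  have v_cont: "continuous_on {0..a} v" using \<omega>(1) by (simp add: RL_space_def v_def)
  have v_D: "v = (\<lambda>y. 1 / Gamma (1 - \<beta>) * D y)" by (simp add: v_def RL_deriv_def D_def fun_eq_iff)
  have v': "(v has_vector_derivative N v x / x powr \<beta>) (at x within {0..a})" if x: "x \<in> {0<..a}" for x
  proof -
    have "D differentiable (at x within {0..a})"
      using \<omega>(2) x by (simp add: is_solution_def RL_twice_differentiable_def D_def[abs_def] flip: assms(1))
    then have "(D has_vector_derivative vector_derivative D (at x within {0..a})) (at x within {0..a})"
      by (simp flip: vector_derivative_works)
    then have "(v has_vector_derivative 1 / Gamma (1 - \<beta>) * vector_derivative D (at x within {0..a}))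
        (at x within {0..a})"
      unfolding v_D by (rule has_vector_derivative_mult_right)
    also have "1 / Gamma (1 - \<beta>) * vector_derivative D (at x within {0..a}) = RL_deriv2 \<sigma> a \<omega> x"
      by (simp add: RL_deriv2_def D_def[abs_def] assms(1))
    also have "\<dots> = f (x, \<omega> x, v x)"
      using \<omega>(2) x by (simp add: is_solution_def v_def flip: assms(1))
    also have "\<dots> = N v x / x powr \<beta>"
      using RL_space_eq_J[OF \<omega>(1), of x] f[OF x] x by (simp add: N_def v_def)
    finally show ?thesis .
  qed
  have "v x = b + integral {0..x} (\<lambda>t. N v t / t powr \<beta>)" if x: "x \<in> {0..a}" for x
  proof -
    \<comment> \<open>The derivative may be unbounded near \<open>0\<close>; continuity of
      \<open>v\<close> on the closed interval suffices for the interior form of the fundamental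
      theorem.\<close>
    have ftc: "((\<lambda>t. N v t / t powr \<beta>) has_integral v x - v 0) {0..x}"
    proof (rule fundamental_theorem_of_calculus_interior)
      show "continuous_on {0..x} v" using x by (intro continuous_on_subset[OF v_cont]) auto
      fix t assume "t \<in> {0<..<x}"
      then have t: "t \<in> {0<..a}" "t \<in> interior {0..a}" using x by auto
      show "(v has_vector_derivative N v t / t powr \<beta>) (at t)"
        using v'[OF t(1)] at_within_interior[OF t(2)] by simp
    qed (use x in auto)
    have "v 0 = b" using \<omega>(2) by (simp add: is_solution_def v_def flip: assms(1))
    with integral_unique[OF ftc] show ?thesis by linarith
  qed
  with v_cont show ?thesis unfolding is_fixpoint_def v_def by blast
qed

end

section \<open>Linear growth of the right-hand side, and the theorem\<close>

lemma linear_growth_of_modulus: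
  fixes F :: "real \<times> real \<times> real \<Rightarrow> real" and g :: "real \<Rightarrow> real" and p C T :: real
  assumes F_cont: "continuous_on ({0..T} \<times> UNIV \<times> UNIV) F"
    and g: "\<And>u. u \<ge> 0 \<Longrightarrow> g u \<ge> 0" "mono_on {0..} g" and "p > 0" "C \<ge> 0"
    and F_diff: "\<And>x w1 v1 w2 v2. x \<in> {0..T} \<Longrightarrow>
        \<bar>F (x, w1, v1) - F (x, w2, v2)\<bar> \<le> C * g (\<bar>w1 - w2\<bar> powr p + \<bar>v1 - v2\<bar> powr p) powr (1 / p)"
  obtains L where "L > 0" "\<And>x w v. x \<in> {0..T} \<Longrightarrow> \<bar>F (x, w, v)\<bar> \<le> L * (1 + \<bar>w\<bar> + \<bar>v\<bar>)"
proof -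
  \<comment> \<open>The cost of one step that moves each coordinate by at most \<open>1\<close>; the
    argument of \<open>g\<close> is then at most \<open>1 + 1\<close>.\<close>
  define E where "E = C * g 2 powr (1 / p)"
  have E: "E \<ge> 0" unfolding E_def using \<open>C \<ge> 0\<close> by simp
  have step: "\<bar>F (x, w1, v1) - F (x, w2, v2)\<bar> \<le> E"
    if "x \<in> {0..T}" "\<bar>w1 - w2\<bar> \<le> 1" "\<bar>v1 - v2\<bar> \<le> 1" for x w1 v1 w2 v2
  proof -
    have "\<bar>w1 - w2\<bar> powr p \<le> 1" "\<bar>v1 - v2\<bar> powr p \<le> 1" using that \<open>p > 0\<close> by (auto intro: powr_le1)
    then have "g (\<bar>w1 - w2\<bar> powr p + \<bar>v1 - v2\<bar> powr p) \<le> g 2" by (intro mono_onD[OF g(2)]) auto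
    then have "C * g (\<bar>w1 - w2\<bar> powr p + \<bar>v1 - v2\<bar> powr p) powr (1 / p) \<le> E"
      unfolding E_def using \<open>C \<ge> 0\<close> \<open>p > 0\<close> by (intro mult_left_mono powr_mono2 g(1)) auto
    with F_diff[OF that(1)] show ?thesis by (rule order_trans)
  qed
  have chain: "\<bar>F (x, real n * w, real n * v) - F (x, 0, 0)\<bar> \<le> real n * E"
    if "x \<in> {0..T}" "\<bar>w\<bar> \<le> 1" "\<bar>v\<bar> \<le> 1" for x w v n
  proof (induction n)
    case (Suc n)
    have "\<bar>F (x, real (Suc n) * w, real (Suc n) * v) - F (x, real n * w, real n * v)\<bar> \<le> E"
      using that by (intro step) (auto simp: algebra_simps)
    with Suc show ?case by (simp add: algebra_simps)
  qed simp
  have "continuous_on {0..T} (\<lambda>x. F (x, 0, 0))"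
    by (intro continuous_on_compose2[OF F_cont] continuous_intros) auto
  then have "bounded ((\<lambda>x. F (x, 0, 0)) ` {0..T})"
    by (intro compact_imp_bounded compact_continuous_image) auto
  then obtain B where B: "B > 0" "\<And>x. x \<in> {0..T} \<Longrightarrow> \<bar>F (x, 0, 0)\<bar> \<le> B"
    unfolding bounded_pos by auto
  have "\<bar>F (x, w, v)\<bar> \<le> (B + E) * (1 + \<bar>w\<bar> + \<bar>v\<bar>)" if x: "x \<in> {0..T}" for x w v
  proof -
    \<comment> \<open>Enough steps to make each of length at most \<open>1\<close>, positive so that
      division by \<open>n\<close> is legitimate, and at most
      \<open>1 + \<bar>w\<bar> + \<bar>v\<bar>\<close>.\<close>
    define n where "n = Suc (nat \<lfloor>\<bar>w\<bar> + \<bar>v\<bar>\<rfloor>)"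
    have n: "\<bar>w\<bar> + \<bar>v\<bar> \<le> real n" "real n \<le> 1 + \<bar>w\<bar> + \<bar>v\<bar>" "n > 0" by (auto simp: n_def) linarith+
    have "\<bar>w / real n\<bar> \<le> 1" "\<bar>v / real n\<bar> \<le> 1" using n by (auto simp: abs_le_iff field_simps)
    from chain[OF x this, of n] n have "\<bar>F (x, w, v) - F (x, 0, 0)\<bar> \<le> real n * E" by simp
    also have "\<dots> \<le> (1 + \<bar>w\<bar> + \<bar>v\<bar>) * E" using n E by (intro mult_right_mono)
    finally have "\<bar>F (x, w, v)\<bar> \<le> B + (1 + \<bar>w\<bar> + \<bar>v\<bar>) * E" using B(2)[OF x] by linarith
    also have "B \<le> (1 + \<bar>w\<bar> + \<bar>v\<bar>) * B" using B(1) by (simp add: algebra_simps)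
    finally show ?thesis by (simp add: algebra_simps)
  qed
  moreover have "B + E > 0" using B(1) E by simp
  ultimately show ?thesis using that by blast
qed

text \<open>Ensures that the interval of the theorem is nondegenerate.\<close>

lemma existence_time_pos:
  assumes "1 < \<sigma>" "\<sigma> < 2" "T > 0" "b \<noteq> 0" "r > 0" "M > 0"
  shows "existence_time \<sigma> T b r M > 0"
proof -
  have "bound_const b \<sigma> M > 0"
    unfolding bound_const_def using assms
    by (intro add_pos_pos mult_pos_pos divide_pos_pos) (auto intro: Gamma_real_pos)
  then show ?thesis using assms unfolding existence_time_def Let_def by auto
qed

text \<open>The bounds are stated for the extension \<open>F\<close>, so that they include
  \<open>x = 0\<close>. Uniqueness is equality on \<open>{0..a}\<close>, since functions are total
  and their values elsewhere are irrelevant.\<close>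

theorem theorem3p4:
  fixes \<sigma> T b r M T0 T0s a p q C :: real
    and f F :: "real \<times> real \<times> real \<Rightarrow> real"
    and g :: "real \<Rightarrow> real"
  assumes "1 < \<sigma>" "\<sigma> < 2" "T > 0" "b \<noteq> 0"
    and f_cont: "continuous_on ({0<..T} \<times> UNIV \<times> UNIV) f"
    and F_ext: "weighted_extension \<sigma> T f F"
    and "r > 0" "M > 0"
    and F_bound: "\<And>r1 r2 x w v. r1 \<ge> 0 \<Longrightarrow> r2 \<ge> 0 \<Longrightarrow> r1 + r2 \<le> r \<Longrightarrow>
        x \<in> {0..T} \<Longrightarrow> w \<in> {-r1..r1} \<Longrightarrow> v \<in> {b - r2..b + r2} \<Longrightarrow> \<bar>F (x, w, v)\<bar> \<le> M"
    and T0: "T0 = existence_time \<sigma> T b r M"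
    and T0s: "T0s = min T0 1"
    and "p > 1" "q > 1" "1 / p + 1 / q = 1" "1 + (1 - \<sigma>) * q > 0"
    and "C > 0"
    and C_bound: "C powr q \<ge> 2 * max
        (b * Gamma \<sigma> powr q * inverse (T0 * Gamma (1 + (1 - \<sigma>) * q) * Gamma (1 + (\<sigma> - 1) * q)))
        ((1 + (1 - \<sigma>) * q) * T0 powr (- 1 - q * (1 - \<sigma>)))"
    and g: "continuous_on {0..} g" "\<And>u. u \<ge> 0 \<Longrightarrow> g u \<ge> 0" "mono_on {0..} g" "g 0 = 0" "osgood g"
    and F_diff: "\<And>x t11 t21 t12 t22. x \<in> {0..T} \<Longrightarrow>
        \<bar>F (x, t11, t21) - F (x, t12, t22)\<bar>
          \<le> C * (g (\<bar>t11 - t12\<bar> powr p + \<bar>t21 - t22\<bar> powr p)) powr (1 / p)"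
    and a: "a = min T0s T"  \<comment> \<open>the interval \<open>[0,T0s]\<close>, cut off where \<open>f\<close> ceases to be defined\<close>
  shows "(\<exists>\<omega>\<in>RL_space (\<sigma> - 1) a. is_solution \<sigma> b a f \<omega>) \<and>
    (\<forall>\<omega>1\<in>RL_space (\<sigma> - 1) a. \<forall>\<omega>2\<in>RL_space (\<sigma> - 1) a.
       is_solution \<sigma> b a f \<omega>1 \<longrightarrow> is_solution \<sigma> b a f \<omega>2 \<longrightarrow> (\<forall>x\<in>{0..a}. \<omega>1 x = \<omega>2 x))"
proof -
  define \<beta> where "\<beta> = \<sigma> - 1"
  have \<beta>: "0 < \<beta>" "\<beta> < 1" using \<open>1 < \<sigma>\<close> \<open>\<sigma> < 2\<close> by (auto simp: \<beta>_def)
  have "T0 > 0" unfolding T0 by (rule existence_time_pos) fact+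
  then have "a > 0" "a \<le> T" using \<open>T > 0\<close> by (auto simp: a T0s)
  have F_cont: "continuous_on ({0..T} \<times> UNIV \<times> UNIV) F"
    and f: "\<And>x w v. x \<in> {0<..a} \<Longrightarrow> F (x, w, v) = x powr \<beta> * f (x, w, v)"
    using F_ext \<open>a \<le> T\<close> by (auto simp: weighted_extension_def \<beta>_def)
  obtain L where L: "L > 0" "\<And>x w v. x \<in> {0..T} \<Longrightarrow> \<bar>F (x, w, v)\<bar> \<le> L * (1 + \<bar>w\<bar> + \<bar>v\<bar>)"
    by (rule linear_growth_of_modulus[OF F_cont g(2,3) _ _ F_diff]) (use \<open>p > 1\<close> \<open>C > 0\<close> in auto)
  interpret fractional_volterra_linear_growth \<beta> a b F L
  proof
    show "continuous_on ({0..a} \<times> UNIV \<times> UNIV) F"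
      using \<open>a \<le> T\<close> by (intro continuous_on_subset[OF F_cont]) auto
    show "\<bar>F (x, w, v)\<bar> \<le> L * (1 + \<bar>w\<bar> + \<bar>v\<bar>)" if "x \<in> {0..a}" for x w v
      using that \<open>a \<le> T\<close> by (intro L(2)) auto
  qed (use \<beta> \<open>a > 0\<close> L(1) in auto)
  have existence: "\<exists>\<omega>\<in>RL_space \<beta> a. is_solution \<sigma> b a f \<omega>"
  proof -
    obtain v where v: "is_fixpoint v" using ex_fixpoint by blast
    then have "J v \<in> RL_space \<beta> a" by (intro J_in_RL_space) (simp add: is_fixpoint_def)
    with fixpoint_imp_solution[OF \<beta>_def f v] show ?thesis by blast
  qed
  have "\<omega>1 x = \<omega>2 x"
    if \<omega>: "\<omega>1 \<in> RL_space \<beta> a" "\<omega>2 \<in> RL_space \<beta> a" "is_solution \<sigma> b a f \<omega>1" "is_solution \<sigma> b a f \<omega>2"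
      and x: "x \<in> {0..a}" for \<omega>1 \<omega>2 x
  proof -
    \<comment> \<open>The fractional derivatives are compared first, as fixed points of the integral
      equation; applying \<open>J\<close> recovers the solutions.\<close>
    have "RL_deriv \<beta> a \<omega>1 t = RL_deriv \<beta> a \<omega>2 t" if "t \<in> {0..a}" for t
    proof (rule fixpoint_unique[OF g(1,2,3,5) \<open>p > 1\<close> _ _ _ _ that])
      show "is_fixpoint (RL_deriv \<beta> a \<omega>1)" "is_fixpoint (RL_deriv \<beta> a \<omega>2)"
        using solution_imp_fixpoint[OF \<beta>_def f] \<omega> by blast+
      show "\<bar>F (y, w1, v1) - F (y, w2, v2)\<bar> \<le> C * g (\<bar>w1 - w2\<bar> powr p + \<bar>v1 - v2\<bar> powr p) powr (1 / p)"
        if "y \<in> {0..a}" for y w1 v1 w2 v2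
        using that \<open>a \<le> T\<close> by (intro F_diff) auto
    qed (use \<open>C > 0\<close> in auto)
    then have "J (RL_deriv \<beta> a \<omega>1) x = J (RL_deriv \<beta> a \<omega>2) x" using x by (intro J_cong) auto
    then show ?thesis using RL_space_eq_J[OF \<omega>(1) x] RL_space_eq_J[OF \<omega>(2) x] by simp
  qed
  with existence show ?thesis unfolding \<beta>_def by blast
qed

end
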